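(* The power law modulus $G^*(\omega)=G_0(i\omega\tau_0)^\beta$ with $0<\beta<1$ admits no exact representation by a relaxation spectrum in the Extended Fox class $\mathcal Q$.
   Context: Here $\omega>0$ is angular frequency, and $G_0$, $\tau_0$ are positive constants. A relaxation spectrum $H(\tau)$, $\tau>0$, represents $G^*$ if $G^*(\omega)=G_\infty+\int_0^\infty\frac{i\omega\tau}{1+i\omega\tau}H(\tau)\frac{d\tau}{\tau}$; in Mellin space this reads $\tilde G(s)=\tilde K(s)\tilde H(-s)$ with $\tilde K(s)=\pi e^{i\pi(1-s)/2}\csc(\pi s)$, where $\tilde G$ is the Mellin transform in $\omega$ of $G^*(\omega)-G_\infty$ and $\tilde H$ that of $H$. The Mellin transform is $\tilde f(s)=\int_0^\infty t^{s-1}f(t)\,dt$, extended by analytic continuation and to distributions; in this proposition the paper uses the distributional Mellin transform $\tilde G(s)=G_0\tau_0^\beta\,\delta(s+\beta)$ of the power-law modulus, with $\delta$ the Dirac distribution. Class $\mathcal H$: functions $\prod_{i=1}^N\Gamma(a_is+b_i)\big/\prod_{j=1}^M\Gamma(c_js+d_j)$ with $a_i,c_j>0$, $N,M<\infty$. Extended Fox class $\mathcal Q$: functions $\tilde H(s)=H_\Gamma(s)Q(s)$ with $H_\Gamma\in\mathcal H$ and $Q(s)=\exp(P(s))$, $P$ entire. A relaxation spectrum is said to be in $\mathcal Q$ if its Mellin transform $\tilde H$ is in $\mathcal Q$. *)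

theory Defs
  imports "HOL-Complex_Analysis.Complex_Analysis"
begin

section \<open>The classes of Mellin-space functions\<close>

text \<open>
  \<^term>\<open>Gamma\<close> has value 0 at its poles and division by 0 gives 0, so an element of the classes
  below carries its proper values only away from a discrete set.  Accordingly, these functions are
  only ever compared with Mellin transforms up to a discrete set or under an integral over a line.
\<close>

definition gamma_class :: "(complex \<Rightarrow> complex) set" where
  "gamma_class = {F. \<exists>(N::nat) (M::nat) (a::nat \<Rightarrow> real) (b::nat \<Rightarrow> complex)
                       (c::nat \<Rightarrow> real) (d::nat \<Rightarrow> complex).
      (\<forall>i<N. a i > 0) \<and> (\<forall>j<M. c j > 0) \<and>
      F = (\<lambda>s. (\<Prod>i<N. Gamma (of_real (a i) * s + b i)) /
               (\<Prod>j<M. Gamma (of_real (c j) * s + d j)))}"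

definition extended_fox_class :: "(complex \<Rightarrow> complex) set" where
  "extended_fox_class = {F. \<exists>H\<^sub>\<Gamma> P. H\<^sub>\<Gamma> \<in> gamma_class \<and> P holomorphic_on UNIV \<and>
      F = (\<lambda>s. H\<^sub>\<Gamma> s * exp (P s))}"


section \<open>Mellin transforms\<close>

definition mellin_integrable_on :: "real set \<Rightarrow> (real \<Rightarrow> complex) \<Rightarrow> complex \<Rightarrow> bool" where
  "mellin_integrable_on A f s \<longleftrightarrow>
     set_integrable lborel A (\<lambda>t. of_real t powr (s - 1) * f t)"

definition mellin_on :: "real set \<Rightarrow> (real \<Rightarrow> complex) \<Rightarrow> complex \<Rightarrow> complex" where
  "mellin_on A f s = (LINT t:A|lborel. of_real t powr (s - 1) * f t)"

abbreviation mellin :: "(real \<Rightarrow> complex) \<Rightarrow> complex \<Rightarrow> complex" where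
  "mellin \<equiv> mellin_on {0<..}"

text \<open>
  Mellin transform extended by analytic continuation.  The parts of the integral over \<open>(0,1)\<close> and
  \<open>[1,\<infinity>)\<close> converge on a right and on a left half plane, respectively; each is continued
  meromorphically to the plane and the continuations are added.  If the half planes overlap
  (\<open>A < B\<close>), the integral over \<open>(0,\<infinity>)\<close> converges on the strip \<open>A < Re s < B\<close>, and the
  definition says that \<open>F\<close> is its meromorphic continuation: given such a continuation \<open>F\<close>, each
  part continues to the plane too, being the difference of \<open>F\<close> and the other part.
\<close>

definition has_continued_mellin ::
    "(real \<Rightarrow> complex) \<Rightarrow> (complex \<Rightarrow> complex) \<Rightarrow> bool" where
  "has_continued_mellin f F \<longleftrightarrow>
     (\<exists>(A::real) (B::real) F\<^sub>0 F\<^sub>1. F\<^sub>0 meromorphic_on UNIV \<and> F\<^sub>1 meromorphic_on UNIV \<and>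
        (\<forall>s. Re s > A \<longrightarrow> mellin_integrable_on {0<..<1} f s \<and> F\<^sub>0 s = mellin_on {0<..<1} f s) \<and>
        (\<forall>s. Re s < B \<longrightarrow> mellin_integrable_on {1..} f s \<and> F\<^sub>1 s = mellin_on {1..} f s) \<and>
        (\<forall>\<^sub>\<approx>s. F s = F\<^sub>0 s + F\<^sub>1 s))"

text \<open>Smooth functions with compact support in \<open>(0,\<infinity>)\<close>; \<open>D n\<close> is the \<open>n\<close>-th derivative.\<close>

definition test_function :: "(real \<Rightarrow> complex) \<Rightarrow> bool" where
  "test_function g \<longleftrightarrow>
     (\<exists>D::nat \<Rightarrow> real \<Rightarrow> complex. D 0 = g \<and>
        (\<forall>n t. (D n has_vector_derivative D (Suc n) t) (at t))) \<and>
     (\<exists>a b. 0 < a \<and> a < b \<and> (\<forall>t. t \<notin> {a..b} \<longrightarrow> g t = 0))"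

text \<open>
  A distribution on \<open>(0,\<infinity>)\<close> is given by its values on test functions.  Its Mellin transform
  is transported by the Parseval formula
  \<open>\<integral>\<^sub>0\<^sup>\<infinity> f(t) g(t) dt = (1 / 2\<pi>i) \<integral> f~(s) g~(1 - s) ds\<close> (over a line \<open>Re s = c\<close>):
  it is the functional that takes the value \<open>T g\<close> on the entire function \<open>s \<mapsto> g~(1 - s)\<close>.
  It is the function \<open>F\<close> on the line \<open>Re s = c\<close> if \<open>T g\<close> is given by integration against \<open>F\<close>,
  and it is \<open>C \<delta>(s - s\<^sub>0)\<close> if \<open>T g = C g~(1 - s\<^sub>0)\<close>
  (\<open>\<delta>\<close> being taken with respect to \<open>ds / 2\<pi>i\<close>).
\<close>

definition dist_of :: "(real \<Rightarrow> complex) \<Rightarrow> (real \<Rightarrow> complex) \<Rightarrow> complex" where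
  "dist_of f g = (LINT t:{0<..}|lborel. f t * g t)"

definition dist_mellin_is_function ::
    "((real \<Rightarrow> complex) \<Rightarrow> complex) \<Rightarrow> real \<Rightarrow> (complex \<Rightarrow> complex) \<Rightarrow> bool" where
  "dist_mellin_is_function T c F \<longleftrightarrow>
     (\<forall>g. test_function g \<longrightarrow>
        integrable lborel (\<lambda>y. F (Complex c y) * mellin g (1 - Complex c y)) \<and>
        T g = 1 / (2 * of_real pi) *
              (LINT y|lborel. F (Complex c y) * mellin g (1 - Complex c y)))"

definition dist_mellin_is_delta ::
    "((real \<Rightarrow> complex) \<Rightarrow> complex) \<Rightarrow> complex \<Rightarrow> complex \<Rightarrow> bool" where
  "dist_mellin_is_delta T C s\<^sub>0 \<longleftrightarrow> (\<forall>g. test_function g \<longrightarrow> T g = C * mellin g (1 - s\<^sub>0))"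

definition has_distributional_mellin ::
    "(real \<Rightarrow> complex) \<Rightarrow> (complex \<Rightarrow> complex) \<Rightarrow> bool" where
  "has_distributional_mellin f F \<longleftrightarrow>
     (\<forall>a b. 0 < a \<longrightarrow> set_integrable lborel {a..b} f) \<and>
     (\<exists>c. dist_mellin_is_function (dist_of f) c F)"

definition has_mellin :: "(real \<Rightarrow> complex) \<Rightarrow> (complex \<Rightarrow> complex) \<Rightarrow> bool" where
  "has_mellin f F \<longleftrightarrow> has_continued_mellin f F \<or> has_distributional_mellin f F"


section \<open>Relaxation spectra\<close>

definition represents ::
    "(real \<Rightarrow> complex) \<Rightarrow> complex \<Rightarrow> (real \<Rightarrow> complex) \<Rightarrow> bool" where
  "represents H Ginf G \<longleftrightarrow>
     (\<forall>\<omega>>0.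
        set_integrable lborel {0<..}
          (\<lambda>\<tau>. \<i> * of_real (\<omega> * \<tau>) / (1 + \<i> * of_real (\<omega> * \<tau>)) * H \<tau> / of_real \<tau>) \<and>
        G \<omega> = Ginf + (LINT \<tau>:{0<..}|lborel.
          \<i> * of_real (\<omega> * \<tau>) / (1 + \<i> * of_real (\<omega> * \<tau>)) * H \<tau> / of_real \<tau>))"

definition spectrum_in :: "(real \<Rightarrow> complex) \<Rightarrow> (complex \<Rightarrow> complex) set \<Rightarrow> bool" where
  "spectrum_in H Q \<longleftrightarrow> (\<exists>F\<in>Q. has_mellin H F)"

definition mellin_kernel :: "complex \<Rightarrow> complex" where
  "mellin_kernel s = of_real pi * exp (\<i> * of_real pi * (1 - s) / 2) / sin (of_real pi * s)"

text \<open>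
  The representation in Mellin space.  It is stated for the transform \<open>F\<close> of the spectrum
  alone, hence also applies when the spectrum is only a distribution.
\<close>

definition mellin_represents ::
    "(complex \<Rightarrow> complex) \<Rightarrow> complex \<Rightarrow> (real \<Rightarrow> complex) \<Rightarrow> bool" where
  "mellin_represents F Ginf G \<longleftrightarrow>
     has_mellin (\<lambda>\<omega>. G \<omega> - Ginf) (\<lambda>s. mellin_kernel s * F (- s))"

definition power_law :: "real \<Rightarrow> real \<Rightarrow> real \<Rightarrow> real \<Rightarrow> complex" where
  "power_law G\<^sub>0 \<tau>\<^sub>0 \<beta> \<omega> = of_real G\<^sub>0 * (\<i> * of_real (\<omega> * \<tau>\<^sub>0)) powr of_real \<beta>"

text \<open>
  The distributional Mellin transform of the power law is a multiple of \<open>\<delta>(s + \<beta>)\<close>.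
\<close>

lemma power_law_mellin_delta:
  assumes "\<tau>\<^sub>0 > 0"
  shows "dist_mellin_is_delta (dist_of (power_law G\<^sub>0 \<tau>\<^sub>0 \<beta>))
           (of_real G\<^sub>0 * of_real \<tau>\<^sub>0 powr of_real \<beta> * \<i> powr of_real \<beta>) (- of_real \<beta>)"
proof -
  have eq: "power_law G\<^sub>0 \<tau>\<^sub>0 \<beta> t =
      (of_real G\<^sub>0 * of_real \<tau>\<^sub>0 powr of_real \<beta> * \<i> powr of_real \<beta>) * of_real t powr of_real \<beta>"
    if "t > 0" for t
  proof -
    have "(\<i> * of_real (t * \<tau>\<^sub>0)) powr of_real \<beta> = (of_real t * (of_real \<tau>\<^sub>0 * \<i>)) powr of_real \<beta>"
      by (simp add: mult_ac)
    also have "\<dots> = of_real t powr of_real \<beta> * (of_real \<tau>\<^sub>0 * \<i>) powr of_real \<beta>"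
      using that by (intro powr_times_real_left) auto
    also have "(of_real \<tau>\<^sub>0 * \<i>) powr of_real \<beta> = of_real \<tau>\<^sub>0 powr of_real \<beta> * \<i> powr of_real \<beta>"
      using assms by (intro powr_times_real_left) auto
    finally show ?thesis
      by (simp add: power_law_def mult_ac)
  qed
  show ?thesis
    unfolding dist_mellin_is_delta_def
  proof (intro allI impI)
    fix g
    let ?C = "of_real G\<^sub>0 * of_real \<tau>\<^sub>0 powr of_real \<beta> * \<i> powr of_real \<beta> :: complex"
    have "dist_of (power_law G\<^sub>0 \<tau>\<^sub>0 \<beta>) g =
          (LINT t:{0<..}|lborel. ?C * (of_real t powr of_real \<beta> * g t))"
      unfolding dist_of_def by (rule set_lebesgue_integral_cong) (auto simp: eq mult_ac)
    also have "\<dots> = ?C * (LINT t:{0<..}|lborel. of_real t powr of_real \<beta> * g t)"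
      by (rule set_integral_mult_right)
    finally show "dist_of (power_law G\<^sub>0 \<tau>\<^sub>0 \<beta>) g = ?C * mellin g (1 - - of_real \<beta>)"
      by (simp add: mellin_on_def)
  qed
qed

end

theory Submission
  imports Defs
begin

text \<open>
  On the function side, the representation forces the spectrum to be \<open>h \<tau> powr (-\<beta>)\<close> almost everywhere
  with \<open>h \<noteq> 0\<close>, because the Stieltjes transform is injective.  So in both parts some
  \<open>f t = C t powr p - D\<close> with \<open>C \<noteq> 0\<close> and \<open>p \<noteq> 0\<close> has a Mellin transform \<open>F\<close> whose zeros are countable.
  The continued transform of \<open>f\<close> is zero, as the pieces over \<open>(0,1)\<close> and \<open>[1,\<infinity>)\<close> continue to opposite
  rational functions.  The distributional transform is a combination of Dirac distributions and not a
  function: pairing \<open>F\<close> on a line with all dilations of one test function gives an integrable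
  function whose Fourier transform is a nonzero combination of exponentials.
\<close>

section \<open>A smooth bump function\<close>

text \<open>In the distributional case \<open>F\<close> is known only through integrals over one
  line \<open>Re s = c\<close> with \<open>c\<close> arbitrary, so no analytic property of it can be
  exploited. Dilations act on such a line by characters times a growth factor, which turns the
  question into whether an integrable function can have an exponential as its Fourier transform. The
  constant \<open>D\<close> stands for the free value \<open>Ginf\<close> in the Mellin-space claim;
  it contributes a second exponential, of a different rate because \<open>p \<noteq> 0\<close>. In
  the continued case a pure power has no strip of convergence: the two half planes lie on opposite
  sides of one line, and only the sum of the continuations has a meaning. Since \<open>Gamma\<close>
  and division take the value 0 at exceptional points, members of the class may vanish there by
  convention; what survives is that these points are countable, and a transform that is zero off a
  sparse set contradicts this. On the function side \<open>Ginf\<close> is unknown too, so the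
  Stieltjes transform to be inverted is at first only known to be constant; its decay at infinity
  forces the constant to be 0.\<close>

definition flat :: "real poly \<Rightarrow> real \<Rightarrow> real" where
  "flat P x = (if x > 0 then poly P (1 / x) * exp (- (1 / x)) else 0)"

lemma poly_times_exp_tendsto_0:
  fixes P :: "real poly"
  shows "((\<lambda>y. poly P y * exp (- y)) \<longlongrightarrow> 0) at_top"
proof -
  have "((\<lambda>y. \<Sum>i\<le>degree P. coeff P i * (y ^ i / exp y)) \<longlongrightarrow> (\<Sum>i\<le>degree P. coeff P i * 0)) at_top"
    by (intro tendsto_intros tendsto_power_div_exp_0)
  then show ?thesis
    by (simp add: poly_altdef sum_distrib_right exp_minus divide_inverse mult.assoc)
qed

lemma flat_div_tendsto_0: "((\<lambda>h. flat P h / h) \<longlongrightarrow> 0) (at 0)"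
proof (rule filterlim_split_at)
  have "eventually (\<lambda>h::real. h \<in> {-1<..<0}) (at_left 0)"
    by (rule eventually_at_left_real) simp
  then have "eventually (\<lambda>h. flat P h / h = 0) (at_left 0)"
    by eventually_elim (simp add: flat_def)
  then show "((\<lambda>h. flat P h / h) \<longlongrightarrow> 0) (at_left 0)"
    by (rule tendsto_eventually)
next
  \<comment> \<open>\<open>pCons 0 P\<close> multiplies by the variable \<open>1 / h\<close> and so
    absorbs the division by \<open>h\<close>.\<close>
  have "((\<lambda>h. poly (pCons 0 P) (inverse h) * exp (- inverse h)) \<longlongrightarrow> 0) (at_right 0)"
    by (rule filterlim_compose[OF poly_times_exp_tendsto_0 filterlim_inverse_at_top_right])
  moreover have "eventually (\<lambda>h::real. h \<in> {0<..<1}) (at_right 0)"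
    by (rule eventually_at_right_real) simp
  then have "eventually (\<lambda>h. poly (pCons 0 P) (inverse h) * exp (- inverse h) = flat P h / h) (at_right 0)"
    by eventually_elim (simp add: flat_def field_simps)
  ultimately show "((\<lambda>h. flat P h / h) \<longlongrightarrow> 0) (at_right 0)"
    by (rule Lim_transform_eventually)
qed

text \<open>With \<open>y = 1 / x\<close>, differentiating \<open>P(y) exp(-y)\<close> gives
  \<open>y^2 (P(y) - P'(y)) exp(-y)\<close>, and the two \<open>pCons 0\<close> are the factor
  \<open>y^2\<close>. At 0 the difference quotient tends to 0. Thus the functions
  \<open>flat P\<close> are closed under differentiation.\<close>

lemma flat_has_derivative:
  "(flat P has_real_derivative flat (pCons 0 (pCons 0 (P - pderiv P))) x) (at x)"
proof -
  consider "x > 0" | "x < 0" | "x = 0" by linarith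
  then show ?thesis
  proof cases
    case 1
    have "((\<lambda>x. poly P (1 / x) * exp (- (1 / x))) has_real_derivative
        flat (pCons 0 (pCons 0 (P - pderiv P))) x) (at x)"
      using 1 by (auto intro!: derivative_eq_intros DERIV_chain2[OF poly_DERIV]
          simp: flat_def field_simps power2_eq_square)
    moreover have "eventually (\<lambda>y. y \<in> {0<..}) (nhds x)"
      using 1 by (intro eventually_nhds_in_open) auto
    then have "eventually (\<lambda>y. flat P y = poly P (1 / y) * exp (- (1 / y))) (nhds x)"
      by eventually_elim (simp add: flat_def)
    ultimately show ?thesis
      by (subst DERIV_cong_ev[OF refl _ refl]) auto
  next
    case 2
    have "eventually (\<lambda>y. y \<in> {..<0}) (nhds x)"
      using 2 by (intro eventually_nhds_in_open) auto
    then have "eventually (\<lambda>y. flat P y = 0) (nhds x)"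
      by eventually_elim (simp add: flat_def)
    with 2 show ?thesis
      by (subst DERIV_cong_ev[OF refl _ refl]) (auto simp: flat_def)
  next
    case 3
    then show ?thesis
      using flat_div_tendsto_0[of P] by (simp add: DERIV_def flat_def)
  qed
qed

text \<open>A family that contains the bump and is closed under differentiation, so that derivatives
  of all orders exist without a formula for them. Lists represent the finite sums that the product
  rule creates.\<close>

definition bump_family :: "(real \<Rightarrow> real) set" where
  "bump_family = range (\<lambda>L t. \<Sum>(P, Q)\<leftarrow>L. flat P (t - 1) * flat Q (2 - t))"

lemma bump_family_derivative:
  assumes "g \<in> bump_family"
  shows "\<exists>g'\<in>bump_family. \<forall>t. (g has_real_derivative g' t) (at t)"
proof -
  obtain L where g: "g = (\<lambda>t. \<Sum>(P, Q)\<leftarrow>L. flat P (t - 1) * flat Q (2 - t))"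
    using assms unfolding bump_family_def by blast
  have "\<exists>L'. \<forall>t. ((\<lambda>t. \<Sum>(P, Q)\<leftarrow>L. flat P (t - 1) * flat Q (2 - t)) has_real_derivative
          (\<Sum>(P, Q)\<leftarrow>L'. flat P (t - 1) * flat Q (2 - t))) (at t)"
  proof (induction L)
    case Nil
    show ?case by (rule exI[of _ "[]"]) simp
  next
    case (Cons a L)
    obtain P Q where a: "a = (P, Q)" by fastforce
    from Cons obtain L' where L': "((\<lambda>t. \<Sum>(P, Q)\<leftarrow>L. flat P (t - 1) * flat Q (2 - t)) has_real_derivative
          (\<Sum>(P, Q)\<leftarrow>L'. flat P (t - 1) * flat Q (2 - t))) (at t)" for t
      by blast
    define d :: "real poly \<Rightarrow> real poly" where "d P = pCons 0 (pCons 0 (P - pderiv P))" for P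
    have minus: "flat (- Q) x = - flat Q x" for Q x
      by (simp add: flat_def)
    \<comment> \<open>The product rule turns one pair into two; the minus sign from the inner
      function \<open>2 - t\<close> is moved into the polynomial.\<close>
    have "((\<lambda>t. \<Sum>(P, Q)\<leftarrow>a # L. flat P (t - 1) * flat Q (2 - t)) has_real_derivative
          (\<Sum>(P, Q)\<leftarrow>(d P, Q) # (P, - d Q) # L'. flat P (t - 1) * flat Q (2 - t))) (at t)" for t
      unfolding a list.map sum_list.Cons prod.case minus
      by (auto intro!: derivative_eq_intros L' DERIV_chain2[OF flat_has_derivative] simp: d_def)
    then show ?case by blast
  qed
  then show ?thesis
    unfolding g bump_family_def by simp
qed

text \<open>Provides the one concrete test function on which the distributional case is tested.
  Positivity on an interval keeps its Mellin transform away from 0 at real points.\<close>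

lemma ex_bump_test_function:
  obtains g :: "real \<Rightarrow> real" where "test_function (\<lambda>t. of_real (g t))"
    "\<And>t. g t \<ge> 0" "\<And>t. 1 < t \<Longrightarrow> t < 2 \<Longrightarrow> g t > 0"
proof
  define g where "g t = flat 1 (t - 1) * flat 1 (2 - t)" for t
  \<comment> \<open>Dependent choice picks each derivative inside \<open>bump_family\<close>, where
    the next one is again available; the clause for \<open>n = 0\<close> pins the sequence to start
    at \<open>g\<close>.\<close>
  have "\<exists>D. \<forall>n. (D n \<in> bump_family \<and> (n = 0 \<longrightarrow> D n = g)) \<and>
          (\<forall>t. (D n has_real_derivative D (Suc n) t) (at t))"
  proof (rule dependent_nat_choice)
    have "g = (\<lambda>t. \<Sum>(P, Q)\<leftarrow>[(1, 1)]. flat P (t - 1) * flat Q (2 - t))"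
      by (simp add: g_def fun_eq_iff)
    then show "\<exists>x. x \<in> bump_family \<and> (0 = (0::nat) \<longrightarrow> x = g)"
      unfolding bump_family_def by blast
  qed (use bump_family_derivative in auto)
  then obtain D where D: "D 0 = g" "\<And>n t. (D n has_real_derivative D (Suc n) t) (at t)"
    by blast
  show "test_function (\<lambda>t. of_real (g t))"
    unfolding test_function_def
  proof (intro conjI)
    show "\<exists>D. D 0 = (\<lambda>t. complex_of_real (g t)) \<and>
            (\<forall>n t. (D n has_vector_derivative D (Suc n) t) (at t))"
      using D by (intro exI[of _ "\<lambda>n t. of_real (D n t)"])
        (auto intro!: has_vector_derivative_of_real simp: has_real_derivative_iff_has_vector_derivative)
    show "\<exists>a b. 0 < a \<and> a < b \<and> (\<forall>t. t \<notin> {a..b} \<longrightarrow> complex_of_real (g t) = 0)"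
      by (rule exI[of _ 1], rule exI[of _ 2]) (auto simp: g_def flat_def)
  qed
qed (auto simp: flat_def)

section \<open>Mellin transforms of test functions\<close>

lemma test_function_continuous:
  assumes "test_function g"
  shows "continuous_on S g"
  using assms unfolding test_function_def
  by (metis has_vector_derivative_continuous continuous_at_imp_continuous_on)

lemma test_function_dilate:
  assumes "test_function g" "r > 0"
  shows "test_function (\<lambda>t. g (t / r))"
proof -
  obtain D a b where D: "D 0 = g" "\<And>n t. (D n has_vector_derivative D (Suc n) t) (at t)"
    and ab: "0 < a" "a < b" "\<And>t. t \<notin> {a..b} \<Longrightarrow> g t = 0"
    using assms unfolding test_function_def by metis
  show ?thesis
    unfolding test_function_def
  proof (intro conjI)
    have "((\<lambda>t. D n (t / r) /\<^sub>R r ^ n) has_vector_derivative D (Suc n) (t / r) /\<^sub>R r ^ Suc n) (at t)" for n t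
    proof -
      have "((\<lambda>t. t / r) has_vector_derivative 1 / r) (at t)"
        using assms(2) by (auto intro!: derivative_eq_intros simp flip: has_real_derivative_iff_has_vector_derivative)
      from vector_diff_chain_at[OF this D(2)]
      have "((\<lambda>t. D n (t / r)) has_vector_derivative (1 / r) *\<^sub>R D (Suc n) (t / r)) (at t)"
        by (simp add: o_def)
      from has_vector_derivative_scaleR[OF DERIV_const[of "inverse (r ^ n)"] this]
      show ?thesis using assms(2) by (simp add: field_simps)
    qed
    then show "\<exists>D. D 0 = (\<lambda>t. g (t / r)) \<and> (\<forall>n t. (D n has_vector_derivative D (Suc n) t) (at t))"
      by (intro exI[of _ "\<lambda>n t. D n (t / r) /\<^sub>R r ^ n"]) (simp add: D)
    have "g (t / r) = 0" if "t \<notin> {r * a..r * b}" for t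
      using that assms(2) by (intro ab) (auto simp: field_simps)
    then show "\<exists>a b. 0 < a \<and> a < b \<and> (\<forall>t. t \<notin> {a..b} \<longrightarrow> g (t / r) = 0)"
      using ab assms(2) by (intro exI[of _ "r * a"] exI[of _ "r * b"]) auto
  qed
qed

lemma test_function_mellin_integrable:
  assumes "test_function g"
  shows "mellin_integrable_on {0<..} g s"
proof -
  obtain a b where ab: "0 < a" "a < b" "\<And>t. t \<notin> {a..b} \<Longrightarrow> g t = 0"
    using assms unfolding test_function_def by blast
  have "continuous_on {a..b} (\<lambda>t. complex_of_real t powr (s - 1) * g t)"
    using ab by (intro continuous_intros test_function_continuous assms) auto
  then have "set_integrable lborel {a..b} (\<lambda>t. complex_of_real t powr (s - 1) * g t)"
    by (rule borel_integrable_atLeastAtMost')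
  moreover have "indicator {a..b} t *\<^sub>R (complex_of_real t powr (s - 1) * g t) =
      indicator {0<..} t *\<^sub>R (complex_of_real t powr (s - 1) * g t)" for t
    using ab(1) ab(3)[of t] by (auto simp: indicator_def)
  ultimately show ?thesis
    by (simp add: mellin_integrable_on_def set_integrable_def)
qed

lemma set_integrable_dilate_iff:
  fixes f :: "real \<Rightarrow> complex"
  assumes "r > 0"
  shows "set_integrable lborel {0<..} (\<lambda>t. f (r * t)) \<longleftrightarrow> set_integrable lborel {0<..} f"
proof -
  have "indicator {0<..} (r * t) = (indicator {0<..} t :: real)" for t
    using assms by (auto simp: indicator_def zero_less_mult_iff)
  then show ?thesis
    using lborel_integrable_real_affine_iff[of r "\<lambda>t. indicator {0<..} t *\<^sub>R f t" 0] assms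
    by (simp add: set_integrable_def)
qed

lemma set_integral_dilate:
  fixes f :: "real \<Rightarrow> complex"
  assumes "r > 0"
  shows "(LINT t:{0<..}|lborel. f t) = r *\<^sub>R (LINT t:{0<..}|lborel. f (r * t))"
proof -
  have "indicator {0<..} (r * t) = (indicator {0<..} t :: real)" for t
    using assms by (auto simp: indicator_def zero_less_mult_iff)
  then show ?thesis
    using lborel_integral_real_affine[of r "\<lambda>t. indicator {0<..} t *\<^sub>R f t" 0] assms
    by (simp add: set_lebesgue_integral_def)
qed

lemma mellin_dilate:
  assumes "r > 0"
  shows "mellin (\<lambda>t. g (t / r)) s = of_real r powr s * mellin g s"
proof -
  have "mellin (\<lambda>t. g (t / r)) s =
      r *\<^sub>R (LINT t:{0<..}|lborel. of_real (r * t) powr (s - 1) * g t)"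
    unfolding mellin_on_def using assms
    by (subst set_integral_dilate[OF assms]) simp
  also have "(LINT t:{0<..}|lborel. of_real (r * t) powr (s - 1) * g t) =
      (LINT t:{0<..}|lborel. of_real r powr (s - 1) * (of_real t powr (s - 1) * g t))"
    using assms by (intro set_lebesgue_integral_cong) (auto simp: powr_times_real)
  also have "r *\<^sub>R \<dots> = (of_real r * of_real r powr (s - 1)) * mellin g s"
    by (simp add: mellin_on_def scaleR_conv_of_real)
  also have "of_real r * of_real r powr (s - 1) = of_real r powr s"
    using assms by (simp add: powr_diff)
  finally show ?thesis .
qed

text \<open>At a real argument the integrand is nonnegative, and it is positive on the interval from
  1 to 2, which is not a null set.\<close>

lemma mellin_pos:
  assumes g: "test_function (\<lambda>t. of_real (g t))" "\<And>t. g t \<ge> 0" "\<And>t. 1 < t \<Longrightarrow> t < 2 \<Longrightarrow> g t > 0"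
  shows "mellin (\<lambda>t. of_real (g t)) (of_real x) \<noteq> 0"
proof
  have eq: "of_real t powr (of_real x - 1) * of_real (g t) = complex_of_real (t powr (x - 1) * g t)"
    if "t > 0" for t
    using that powr_of_real[of t "x - 1"] by simp
  let ?f = "\<lambda>t. indicator {0<..} t *\<^sub>R (t powr (x - 1) * g t)"
  have eq': "indicator {0<..} t *\<^sub>R (of_real t powr (of_real x - 1) * of_real (g t)) = complex_of_real (?f t)" for t
    using eq[of t] by (auto simp: indicator_def)
  have "integrable lborel (\<lambda>t. complex_of_real (?f t))"
    using test_function_mellin_integrable[OF g(1), of "of_real x"]
    unfolding mellin_integrable_on_def set_integrable_def eq' .
  then have int: "integrable lborel ?f"
    unfolding complex_of_real_integrable_eq .
  assume "mellin (\<lambda>t. of_real (g t)) (of_real x) = 0"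
  then have "complex_of_real (integral\<^sup>L lborel ?f) = 0"
    unfolding mellin_on_def set_lebesgue_integral_def eq' integral_complex_of_real .
  then have "integral\<^sup>L lborel ?f = 0"
    by simp
  then have "AE t in lborel. ?f t = 0"
    using integral_nonneg_eq_0_iff_AE[OF int] g(2) by simp
  then have "AE t in lborel. t \<notin> {1<..<2::real}"
    by eventually_elim (use g(3) in \<open>auto simp: indicator_def split: if_splits\<close>, force)
  then have "{1<..<2::real} \<in> null_sets lborel"
    by (subst (asm) AE_iff_null_sets[symmetric]) auto
  then show False
    by (simp add: null_sets_def)
qed

section \<open>Distributional Mellin transforms of powers\<close>

text \<open>The transform of an integrable function is bounded by its norm, which excludes
  \<open>\<alpha> \<noteq> 0\<close>. For \<open>\<alpha> = 0\<close> a weak form of the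
  Riemann-Lebesgue lemma applies: the transform has mean \<open>A\<close> over the integers
  \<open>0..n\<close>, while the averaged characters tend to 0 off the null set of multiples of
  \<open>2 * pi\<close>, so dominated convergence gives 0.\<close>

lemma fourier_transform_not_exponential:
  fixes \<Psi> :: "real \<Rightarrow> complex" and A :: complex
  assumes int: "integrable lborel \<Psi>"
    and eq: "\<And>x. (LINT y|lborel. \<Psi> y * cis (- x * y)) = A * of_real (exp (\<alpha> * x))"
  shows "A = 0"
proof (cases "\<alpha> = 0")
  case False
  show ?thesis
  proof (rule ccontr)
    assume "A \<noteq> 0"
    have bound: "norm A * exp (\<alpha> * x) \<le> (LINT y|lborel. norm (\<Psi> y))" for x
    proof -
      have "norm (LINT y|lborel. \<Psi> y * cis (- x * y)) \<le> (LINT y|lborel. norm (\<Psi> y * cis (- x * y)))"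
        by (rule integral_norm_bound)
      then show ?thesis
        unfolding eq by (simp add: norm_mult)
    qed
    define b where "b = (LINT y|lborel. norm (\<Psi> y)) / norm A"
    have "b \<ge> 0" unfolding b_def by (intro divide_nonneg_nonneg integral_nonneg) auto
    \<comment> \<open>This \<open>x\<close> makes the exponential equal to \<open>b + 1\<close>,
      beyond the bound \<open>b\<close>, for either sign of \<open>\<alpha>\<close>.\<close>
    have "exp (\<alpha> * (ln (b + 1) / \<alpha>)) \<le> b"
      using bound[of "ln (b + 1) / \<alpha>"] \<open>A \<noteq> 0\<close> by (simp add: b_def field_simps)
    with False \<open>b \<ge> 0\<close> show False by simp
  qed
next
  case True
  \<comment> \<open>Averages of \<open>cis (- j * y)\<close> over \<open>j \<le> n\<close> tend to 0 for almost every \<open>y\<close>.\<close>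
  define k where "k n y = (\<Sum>j<Suc n. cis (- y) ^ j) / of_nat (Suc n)" for n y
  have cis: "cis (- real j * y) = cis (- y) ^ j" for j y
    by (simp only: Complex.DeMoivre mult_minus_left mult_minus_right)
  have meas: "k n \<in> borel_measurable lborel" for n
    unfolding k_def
    by (auto intro!: borel_measurable_continuous_onI continuous_intros simp del: sum.lessThan_Suc of_nat_Suc)
  have [measurable]: "\<Psi> \<in> borel_measurable lborel" "(\<lambda>y. cis (- y)) \<in> borel_measurable lborel"
    using int by (auto intro!: borel_measurable_continuous_onI continuous_intros)
  have int_j: "integrable lborel (\<lambda>y. \<Psi> y * cis (- y) ^ j)" for j
    by (rule Bochner_Integration.integrable_bound[OF int])
      (auto simp: norm_mult norm_power)
  have k_bound: "norm (k n y) \<le> 1" for n y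
  proof -
    have "norm (\<Sum>j<Suc n. cis (- y) ^ j) \<le> (\<Sum>j<Suc n. norm (cis (- y) ^ j))"
      by (rule norm_sum)
    also have "\<dots> = Suc n" by (simp add: norm_power)
    finally show ?thesis by (simp add: k_def norm_divide divide_le_eq del: sum.lessThan_Suc of_nat_Suc)
  qed
  have k_int: "(LINT y|lborel. \<Psi> y * k n y) = A" for n
  proof -
    have "(LINT y|lborel. \<Psi> y * k n y) = (LINT y|lborel. (\<Sum>j<Suc n. \<Psi> y * cis (- y) ^ j) / of_nat (Suc n))"
      by (simp add: k_def sum_distrib_left del: sum.lessThan_Suc)
    also have "\<dots> = (\<Sum>j<Suc n. (LINT y|lborel. \<Psi> y * cis (- y) ^ j)) / of_nat (Suc n)"
      by (subst integral_divide_zero, subst Bochner_Integration.integral_sum) (use int_j in auto)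
    also have "\<dots> = (\<Sum>j<Suc n. A) / of_nat (Suc n)"
      using eq[of "real j" for j] unfolding cis by (simp add: True del: sum.lessThan_Suc)
    also have "\<dots> = A" by (simp del: sum.lessThan_Suc of_nat_Suc)
    finally show ?thesis .
  qed
  have k_lim: "(\<lambda>n. k n y) \<longlonglongrightarrow> 0" if "cis (- y) \<noteq> 1" for y
  proof -
    have "norm (k n y) \<le> (2 / norm (1 - cis (- y))) / real (Suc n)" for n
    proof -
      \<comment> \<open>Numerator of the geometric sum \<open>(1 - z ^ Suc n) / (1 - z)\<close> with
        \<open>z = cis (- y)\<close>.\<close>
      have "norm (1 - cis (- y) ^ Suc n) \<le> 2"
        using norm_triangle_ineq4[of 1 "cis (- y) ^ Suc n"] by (simp add: norm_power norm_mult)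
      then show ?thesis
        using that unfolding k_def sum_gp_strict norm_divide if_not_P[OF that]
        by (simp add: norm_divide divide_right_mono field_simps del: power_Suc of_nat_Suc)
    qed
    moreover have "(\<lambda>n. (2 / norm (1 - cis (- y))) / real (Suc n)) \<longlonglongrightarrow> 0"
      by (rule LIMSEQ_Suc[OF lim_const_over_n])
    ultimately show ?thesis
      by (intro Lim_null_comparison[of "\<lambda>n. k n y"]) auto
  qed
  have "(\<lambda>n. LINT y|lborel. \<Psi> y * k n y) \<longlonglongrightarrow> integral\<^sup>L (lborel :: real measure) (\<lambda>_. 0 :: complex)"
  proof (rule integral_dominated_convergence[where w = "\<lambda>y. norm (\<Psi> y)"])
    have "{y. cis (- y) = 1} \<subseteq> range (\<lambda>n::int. 2 * pi * n)"
      by (auto simp: complex_eq_iff cos_one_2pi_int)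
    then have "countable {y. cis (- y) = 1}"
      by (rule countable_subset) auto
    then have "{y. cis (- y) = 1} \<in> null_sets lborel"
      by (rule countable_imp_null_set_lborel)
    then have "AE y in lborel. cis (- y) \<noteq> 1"
      by (rule AE_I') auto
    then show "AE y in lborel. (\<lambda>n. \<Psi> y * k n y) \<longlonglongrightarrow> 0"
      by eventually_elim (use k_lim tendsto_mult_right_zero in blast)
  qed (use int meas k_bound in \<open>auto simp: norm_mult mult_left_le\<close>)
  then show ?thesis
    by (simp add: k_int LIMSEQ_const_iff)
qed

text \<open>Pairing with the dilation of \<open>\<phi>\<close> by \<open>exp x\<close> shows that
  the Fourier transform of \<open>\<Psi>\<close> is a combination of
  \<open>exp ((c + p) * x)\<close> and \<open>exp (c * x)\<close>, the first with the nonzero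
  coefficient \<open>2 * pi * C * m\<close>. No integrable function has such a transform.\<close>

lemma power_minus_const_dist_mellin_not_function:
  fixes C D :: complex and p c :: real
  assumes "C \<noteq> 0" "p \<noteq> 0"
    and f: "\<And>t. t > 0 \<Longrightarrow> f t = C * of_real t powr of_real p - D"
  shows "\<not> dist_mellin_is_function (dist_of f) c F"
proof
  assume F: "dist_mellin_is_function (dist_of f) c F"
  obtain g where g: "test_function (\<lambda>t. complex_of_real (g t))"
    "\<And>t. g t \<ge> 0" "\<And>t. 1 < t \<Longrightarrow> t < 2 \<Longrightarrow> g t > 0"
    by (rule ex_bump_test_function) blast
  define \<phi> where "\<phi> = (\<lambda>t. complex_of_real (g t))"
  have \<phi>: "test_function \<phi>" using g by (simp add: \<phi>_def)
  define m where "m = mellin \<phi> (of_real (1 + p))"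
  have m: "m \<noteq> 0" unfolding m_def \<phi>_def by (rule mellin_pos[OF g])
  have dist: "dist_of f h = C * mellin h (of_real (1 + p)) - D * mellin h 1" if h: "test_function h" for h
  proof -
    have i1: "set_integrable lborel {0<..} (\<lambda>t. C * (of_real t powr (of_real (1 + p) - 1) * h t))"
      using test_function_mellin_integrable[OF h, of "of_real (1 + p)"]
      unfolding mellin_integrable_on_def by (rule set_integrable_mult_right)
    have i2: "set_integrable lborel {0<..} (\<lambda>t. D * (of_real t powr (1 - 1) * h t))"
      using test_function_mellin_integrable[OF h, of 1]
      unfolding mellin_integrable_on_def by (rule set_integrable_mult_right)
    have "dist_of f h = (LINT t:{0<..}|lborel. C * (of_real t powr (of_real (1 + p) - 1) * h t) -
        D * (of_real t powr (1 - 1) * h t))"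
      unfolding dist_of_def by (intro set_lebesgue_integral_cong) (auto simp: f algebra_simps)
    also have "\<dots> = C * mellin h (of_real (1 + p)) - D * mellin h 1"
      by (subst set_integral_diff[OF i1 i2]) (simp add: mellin_on_def)
    finally show ?thesis .
  qed
  define \<Psi> where "\<Psi> y = F (Complex c y) * mellin \<phi> (1 - Complex c y)" for y
  have int: "integrable lborel \<Psi>"
    using F \<phi> unfolding dist_mellin_is_function_def \<Psi>_def by blast
  define M where "M = mellin \<phi> 1"
  have key: "(LINT y|lborel. \<Psi> y * cis (- x * y)) =
     2 * pi * (C * m * exp ((c + p) * x) - D * M * exp (c * x))" for x
  proof -
    define h where "h t = \<phi> (t / exp x)" for t
    have h: "test_function h"
      unfolding h_def by (rule test_function_dilate[OF \<phi>]) simp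
    have mh: "mellin h s = exp (x * s) * mellin \<phi> s" for s :: complex
      unfolding h_def mellin_dilate[OF exp_gt_zero]
      using exp_powr_complex[of "of_real x" s] pi_gt_zero by (simp add: exp_of_real)
    \<comment> \<open>On the line, the dilation factor \<open>exp (x * (1 - s))\<close> splits into
      the real factor \<open>exp ((1 - c) * x)\<close> and a character in \<open>y\<close>.\<close>
    have K: "F (Complex c y) * mellin h (1 - Complex c y) = of_real (exp ((1 - c) * x)) * (\<Psi> y * cis (- x * y))" for y
    proof -
      have "x * (1 - Complex c y) = of_real ((1 - c) * x) + \<i> * of_real (- x * y)"
        by (simp add: complex_eq_iff)
      then have "exp (x * (1 - Complex c y)) = of_real (exp ((1 - c) * x)) * cis (- x * y)"
        by (simp only: exp_add cis_conv_exp exp_of_real)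
      then show ?thesis by (simp add: mh \<Psi>_def)
    qed
    have "dist_of f h = 1 / (2 * of_real pi) * (LINT y|lborel. F (Complex c y) * mellin h (1 - Complex c y))"
      using F h by (simp add: dist_mellin_is_function_def)
    then have "2 * of_real pi * dist_of f h = (LINT y|lborel. F (Complex c y) * mellin h (1 - Complex c y))"
      by simp
    also have "\<dots> = exp ((1 - c) * x) * (LINT y|lborel. \<Psi> y * cis (- x * y))"
      unfolding K by (rule integral_mult_right_zero)
    also have "dist_of f h = C * (exp (x * (1 + p)) * m) - D * (exp x * M)"
      unfolding dist[OF h] mh m_def M_def
      by (simp only: mult_1_right exp_of_real flip: of_real_mult)
    finally have "2 * pi * (C * (exp (x * (1 + p)) * m) - D * (exp x * M)) =
        exp ((1 - c) * x) * (LINT y|lborel. \<Psi> y * cis (- x * y))"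
      by simp
    \<comment> \<open>Cancelling the real factor shifts the rates \<open>1 + p\<close> and
      \<open>1\<close> to \<open>c + p\<close> and \<open>c\<close>.\<close>
    then have "exp (- (1 - c) * x) * (2 * pi * (C * (exp (x * (1 + p)) * m) - D * (exp x * M))) =
        exp (- (1 - c) * x) * (exp ((1 - c) * x) * (LINT y|lborel. \<Psi> y * cis (- x * y)))"
      by simp
    also have "\<dots> = of_real (exp (- (1 - c) * x) * exp ((1 - c) * x)) * (LINT y|lborel. \<Psi> y * cis (- x * y))"
      by simp
    also have "exp (- (1 - c) * x) * exp ((1 - c) * x) = 1"
      by (simp flip: exp_add add: algebra_simps)
    also have "exp (- (1 - c) * x) * (2 * pi * (C * (exp (x * (1 + p)) * m) - D * (exp x * M))) =
       2 * pi * (C * m * of_real (exp (- (1 - c) * x) * exp (x * (1 + p))) - D * M * of_real (exp (- (1 - c) * x) * exp x))"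
      by (simp add: algebra_simps)
    also have "exp (- (1 - c) * x) * exp (x * (1 + p)) = exp ((c + p) * x)"
      by (simp flip: exp_add add: algebra_simps)
    also have "exp (- (1 - c) * x) * exp x = exp (c * x)"
      by (simp flip: exp_add add: algebra_simps)
    finally show ?thesis by simp
  qed
  \<comment> \<open>Shifting by 1 and subtracting eliminates the exponential coming from the constant \<open>D\<close>.\<close>
  define \<Psi>' where "\<Psi>' y = \<Psi> y * (cis (- y) - exp c)" for y
  have [measurable]: "\<Psi> \<in> borel_measurable lborel" "(\<lambda>y. cis (- x * y)) \<in> borel_measurable lborel" for x
    using int by (auto intro!: borel_measurable_continuous_onI continuous_intros)
  have int': "integrable lborel (\<lambda>y. \<Psi> y * cis (- x * y))" for x
    by (rule Bochner_Integration.integrable_bound[OF int], measurable) (simp add: norm_mult)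
  have \<Psi>': "\<Psi>' y * cis (- x * y) = \<Psi> y * cis (- (x + 1) * y) - exp c * (\<Psi> y * cis (- x * y))" for x y
  proof -
    have "cis (- (x + 1) * y) = cis (- y) * cis (- x * y)"
      by (simp add: cis_mult algebra_simps)
    then show ?thesis by (simp add: \<Psi>'_def algebra_simps)
  qed
  have "2 * pi * C * m * (exp (c + p) - exp c) = 0"
  proof (rule fourier_transform_not_exponential)
    show "integrable lborel \<Psi>'"
    proof -
      have "\<Psi>' = (\<lambda>y. \<Psi> y * cis (- 1 * y) - exp c * \<Psi> y)"
        by (rule ext) (simp add: \<Psi>'_def algebra_simps)
      then show ?thesis
        using int int'[of 1] by simp
    qed
    show "(LINT y|lborel. \<Psi>' y * cis (- x * y)) =
        2 * pi * C * m * (exp (c + p) - exp c) * of_real (exp ((c + p) * x))" for x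
    proof -
      have "(LINT y|lborel. \<Psi>' y * cis (- x * y)) = 
        2 * pi * (C * m * exp ((c + p) * (x + 1)) - D * M * exp (c * (x + 1))) - 
        exp c * (2 * pi * (C * m * exp ((c + p) * x) - D * M * exp (c * x)))"
        unfolding \<Psi>' using int' 
        by (subst Bochner_Integration.integral_diff) (auto simp only: key integral_mult_right_zero integrable_mult_right)
      also have "\<dots> = 2 * pi * C * m * (exp (c + p) - exp c) * of_real (exp ((c + p) * x))"
        by (simp add: distrib_left exp_add) (simp add: algebra_simps)
      finally show ?thesis .
    qed
  qed
  then have "exp (c + p) = exp c"
    using assms(1) m by simp
  with assms(2) show False by simp
qed

section \<open>Continued Mellin transforms of powers\<close>

text \<open>For nonnegative functions gauge integrability is absolute, hence Lebesgue integrability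
  for the completed measure; Borel measurability brings it down to \<open>lborel\<close>.\<close>

lemma set_integral_of_nonneg_has_integral:
  fixes f :: "real \<Rightarrow> real"
  assumes "(f has_integral I) A" "\<And>t. t \<in> A \<Longrightarrow> f t \<ge> 0" and [measurable]: "f \<in> borel_measurable borel" "A \<in> sets borel"
  shows "set_integrable lborel A f" "(LINT t:A|lborel. f t) = I"
proof -
  have "f absolutely_integrable_on A"
    using assms by (intro nonnegative_absolutely_integrable_1) auto
  then show int: "set_integrable lborel A f"
    unfolding set_integrable_def by (subst (asm) integrable_completion) auto
  show "(LINT t:A|lborel. f t) = I"
    using set_borel_integral_eq_integral[OF int] assms(1) by (simp add: integral_unique)
qed

lemma set_integral_powr_0_1:
  fixes q :: real
  assumes "q > 0"
  shows "set_integrable lborel {0<..<1} (\<lambda>t. t powr (q - 1))" "(LINT t:{0<..<1}|lborel. t powr (q - 1)) = 1 / q"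
proof -
  have "((\<lambda>t. t powr (q - 1)) has_integral 1 / q) {0..1}"
    using has_integral_powr_from_0[of "q - 1" 1] assms by simp
  then have "((\<lambda>t. t powr (q - 1)) has_integral 1 / q) {0<..<1}"
    by (simp add: has_integral_Icc_iff_Ioo)
  then show "set_integrable lborel {0<..<1} (\<lambda>t. t powr (q - 1))" "(LINT t:{0<..<1}|lborel. t powr (q - 1)) = 1 / q"
    by (auto intro: set_integral_of_nonneg_has_integral)
qed

lemma set_integral_powr_1_inf:
  fixes q :: real
  assumes "q < 0"
  shows "set_integrable lborel {1..} (\<lambda>t. t powr (q - 1))" "(LINT t:{1..}|lborel. t powr (q - 1)) = - 1 / q"
proof -
  have "((\<lambda>t. t powr (q - 1)) has_integral - 1 / q) {1..}"
    using has_integral_powr_to_inf[of "q - 1" 1] assms by simp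
  then show "set_integrable lborel {1..} (\<lambda>t. t powr (q - 1))" "(LINT t:{1..}|lborel. t powr (q - 1)) = - 1 / q"
    by (auto intro: set_integral_of_nonneg_has_integral)
qed

text \<open>Evaluated at real arguments, where complex powers become real powers with known
  integrals; a real interval is already enough to identify a meromorphic function.\<close>

lemma mellin_on_power_minus_const:
  fixes x p :: real and C D :: complex
  assumes A: "A \<in> sets borel" "A \<subseteq> {0<..}" and f: "\<And>t. t > 0 \<Longrightarrow> f t = C * of_real t powr of_real p - D"
    and int: "set_integrable lborel A (\<lambda>t. t powr (x + p - 1))" "set_integrable lborel A (\<lambda>t. t powr (x - 1))"
  shows "mellin_on A f (of_real x) =
    C * of_real (LINT t:A|lborel. t powr (x + p - 1)) - D * of_real (LINT t:A|lborel. t powr (x - 1))"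
proof -
  have int': "set_integrable lborel A (\<lambda>t. complex_of_real (t powr (x + p - 1)))"
    "set_integrable lborel A (\<lambda>t. complex_of_real (t powr (x - 1)))"
    using int by (simp_all add: set_integrable_def scaleR_conv_of_real complex_of_real_integrable_eq flip: of_real_mult)
  have "mellin_on A f (of_real x) =
      (LINT t:A|lborel. C * of_real (t powr (x + p - 1)) - D * of_real (t powr (x - 1)))"
    unfolding mellin_on_def
  proof (intro set_lebesgue_integral_cong allI impI)
    fix t assume "t \<in> A"
    then have t: "t > 0" using A by auto
    have "of_real t powr (of_real x - 1) = complex_of_real (t powr (x - 1))"
      using powr_of_real[of t "x - 1"] t by simp
    moreover have "of_real t powr (of_real p) = complex_of_real (t powr p)"
      using powr_of_real[of t p] t by simp
    moreover have "t powr (x + p - 1) = t powr (x - 1) * t powr p"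
      by (simp flip: powr_add add: algebra_simps)
    ultimately show "of_real t powr (of_real x - 1) * f t =
        C * of_real (t powr (x + p - 1)) - D * of_real (t powr (x - 1))"
      by (simp add: f t algebra_simps)
  qed (use A in auto)
  then show ?thesis
    using int' by (simp add: set_integral_diff(2) set_integral_complex_of_real)
qed

section \<open>Identification of meromorphic functions and vanishing of the continued
  transform\<close>

lemma eventually_cosparse_imp_countable:
  fixes P :: "complex \<Rightarrow> bool"
  assumes "\<forall>\<^sub>\<approx>z. P z"
  shows "countable {z. \<not> P z}"
  using sparse_imp_countable[of UNIV "{z. \<not> P z}"] assms by (simp add: eventually_cosparse)

text \<open>A meromorphic function on the plane is either 0 or nonzero off a sparse set. For
  \<open>f - g\<close> the second case would make \<open>U\<close> part of a sparse, hence
  countable, set.\<close>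

lemma meromorphic_eq_cosparse:
  assumes "f meromorphic_on UNIV" "g meromorphic_on UNIV"
    and U: "uncountable U" "\<And>z. z \<in> U \<Longrightarrow> f z = g z"
  shows "\<forall>\<^sub>\<approx>z. f z = g z"
proof -
  have "\<not> (\<forall>\<^sub>\<approx>z. f z - g z \<noteq> 0)"
  proof
    assume "\<forall>\<^sub>\<approx>z. f z - g z \<noteq> 0"
    from eventually_cosparse_imp_countable[OF this] have "countable U"
      by (rule countable_subset[rotated]) (use U in auto)
    with U show False by blast
  qed
  moreover have "(\<lambda>z. f z - g z) meromorphic_on UNIV"
    using assms by (intro meromorphic_intros)
  ultimately have "\<forall>\<^sub>\<approx>z. f z - g z = 0"
    using meromorphic_imp_constant_or_avoid[of "\<lambda>z. f z - g z" UNIV 0] by auto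
  then show ?thesis by simp
qed

lemma continued_mellin_power_minus_const_zero:
  fixes C D :: complex and p :: real
  assumes f: "\<And>t. t > 0 \<Longrightarrow> f t = C * of_real t powr of_real p - D"
    and F: "has_continued_mellin f F"
  shows "\<forall>\<^sub>\<approx>s. F s = 0"
proof -
  obtain A B F\<^sub>0 F\<^sub>1 where mero: "F\<^sub>0 meromorphic_on UNIV" "F\<^sub>1 meromorphic_on UNIV"
    and F0: "\<And>s. Re s > A \<Longrightarrow> F\<^sub>0 s = mellin_on {0<..<1} f s"
    and F1: "\<And>s. Re s < B \<Longrightarrow> F\<^sub>1 s = mellin_on {1..} f s"
    and eq: "\<forall>\<^sub>\<approx>s. F s = F\<^sub>0 s + F\<^sub>1 s"
    using F unfolding has_continued_mellin_def by blast
  \<comment> \<open>The integral of \<open>t powr (q - 1)\<close> is \<open>1 / q\<close> over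
    \<open>(0,1)\<close> and \<open>- 1 / q\<close> over \<open>[1,\<infinity>)\<close>;
    \<open>q = s + p\<close> and \<open>q = s\<close> give \<open>R\<close> and
    \<open>- R\<close>.\<close>
  define R where "R = (\<lambda>s. C / (s + of_real p) - D / s)"
  have R: "R meromorphic_on UNIV" "(\<lambda>s. - R s) meromorphic_on UNIV"
    unfolding R_def by (auto intro!: meromorphic_intros)
  have unc: "uncountable (complex_of_real ` {a<..<b})" if "a < b" for a b
    using that by (simp add: countable_image_inj_eq inj_on_def uncountable_open_interval)
  \<comment> \<open>To the right of \<open>a\<close> a real \<open>x\<close> lies in the given half
    plane and both powers are integrable at 0.\<close>
  define a where "a = max A (max 0 (- p))"
  have "\<forall>\<^sub>\<approx>s. F\<^sub>0 s = R s"
  proof (rule meromorphic_eq_cosparse[OF mero(1) R(1)])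
    show "uncountable (complex_of_real ` {a<..<a + 1})" by (rule unc) simp
    fix z assume "z \<in> complex_of_real ` {a<..<a + 1}"
    then obtain x where x: "z = of_real x" "x > A" "x > 0" "x + p > 0"
      by (auto simp: a_def)
    have "F\<^sub>0 z = mellin_on {0<..<1} f (of_real x)"
      using x F0 by simp
    also have "\<dots> = R z"
      unfolding x(1) by (subst mellin_on_power_minus_const[where C = C and D = D and p = p])
        (use f x set_integral_powr_0_1 in \<open>auto simp: R_def divide_inverse\<close>)
    finally show "F\<^sub>0 z = R z" .
  qed
  moreover
  define b where "b = min B (min 0 (- p))"
  have "\<forall>\<^sub>\<approx>s. F\<^sub>1 s = - R s"
  proof (rule meromorphic_eq_cosparse[OF mero(2) R(2)])
    show "uncountable (complex_of_real ` {b - 1<..<b})" by (rule unc) simp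
    fix z assume "z \<in> complex_of_real ` {b - 1<..<b}"
    then obtain x where x: "z = of_real x" "x < B" "x < 0" "x + p < 0"
      by (auto simp: b_def)
    have "F\<^sub>1 z = mellin_on {1..} f (of_real x)"
      using x F1 by simp
    also have "\<dots> = - R z"
      unfolding x(1) by (subst mellin_on_power_minus_const[where C = C and D = D and p = p])
        (use f x set_integral_powr_1_inf in \<open>auto simp: R_def divide_inverse\<close>)
    finally show "F\<^sub>1 z = - R z" .
  qed
  ultimately show ?thesis
    using eq by eventually_elim simp
qed

section \<open>Zeros of the extended Fox class and of the kernel\<close>

lemma countable_gamma_zeros:
  assumes "a > 0"
  shows "countable {s. Gamma (of_real a * s + b) = (0::complex)}"
proof -
  \<comment> \<open>\<open>Gamma\<close> has no genuine zeros; it takes the value 0 exactly at its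
    poles, the nonpositive integers.\<close>
  have "{s. Gamma (of_real a * s + b) = 0} \<subseteq> range (\<lambda>n::int. (of_int n - b) / of_real a)"
  proof
    fix s assume "s \<in> {s. Gamma (of_real a * s + b) = 0}"
    then obtain n where "of_real a * s + b = of_int n"
      by (auto simp: Gamma_eq_zero_iff elim!: nonpos_Ints_cases)
    then have "s = (of_int n - b) / of_real a"
      using assms by (simp add: field_simps)
    then show "s \<in> range (\<lambda>n::int. (of_int n - b) / of_real a)"
      by (rule range_eqI)
  qed
  then show ?thesis by (rule countable_subset) auto
qed

lemma extended_fox_class_countable_zeros:
  assumes "F \<in> extended_fox_class"
  shows "countable {s. F s = 0}"
proof -
  obtain N M a b c d P where pos: "\<And>i. i < (N::nat) \<Longrightarrow> a i > 0" "\<And>j. j < (M::nat) \<Longrightarrow> c j > 0"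
    and F: "F = (\<lambda>s. (\<Prod>i<N. Gamma (of_real (a i) * s + b i)) /
               (\<Prod>j<M. Gamma (of_real (c j) * s + d j)) * exp (P s))"
    using assms unfolding extended_fox_class_def gamma_class_def by blast
  \<comment> \<open>The second union is there because division by 0 gives 0; the factor
    \<open>exp (P s)\<close> never vanishes.\<close>
  have "{s. F s = 0} \<subseteq> (\<Union>i<N. {s. Gamma (of_real (a i) * s + b i) = 0}) \<union>
      (\<Union>j<M. {s. Gamma (of_real (c j) * s + d j) = 0})"
    by (auto simp: F)
  then show ?thesis
    by (rule countable_subset) (auto intro!: countable_gamma_zeros pos)
qed

text \<open>The numerator never vanishes, so the value 0 arises only from division by
  \<open>sin (of_real pi * s) = 0\<close>, that is, at integers.\<close>

lemma mellin_kernel_countable_zeros: "countable {s. mellin_kernel s = 0}"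
proof -
  have "{s. mellin_kernel s = 0} \<subseteq> range (\<lambda>n::int. of_int n)"
    by (auto simp: mellin_kernel_def sin_eq_0)
  then show ?thesis by (rule countable_subset) auto
qed

lemma countable_zeros_not_cosparse_zero:
  fixes F :: "complex \<Rightarrow> complex"
  assumes "countable {s. F s = 0}"
  shows "\<not> (\<forall>\<^sub>\<approx>s. F s = 0)"
proof
  assume "\<forall>\<^sub>\<approx>s. F s = 0"
  then have "countable ({s. F s \<noteq> 0} \<union> {s. F s = 0})"
    using assms by (intro countable_Un eventually_cosparse_imp_countable)
  moreover have "{s. F s \<noteq> 0} \<union> {s. F s = 0} = UNIV" by auto
  ultimately show False
    using uncountable_UNIV_complex by simp
qed

section \<open>Injectivity of the Stieltjes transform\<close>

text \<open>The geometric series for \<open>1 / (1 - q x * w)\<close> may be integrated termwise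
  because its terms are dominated by \<open>norm w ^ n * norm (W x)\<close>. This expands a
  Stieltjes transform around a base point, with moments as coefficients.\<close>

lemma power_series_moments:
  fixes W q :: "'a \<Rightarrow> complex" and w :: complex
  assumes W: "integrable M W" and q[measurable]: "q \<in> borel_measurable M" "\<And>x. x \<in> space M \<Longrightarrow> norm (q x) \<le> 1"
    and w: "norm w < 1"
  shows "(\<lambda>n. (LINT x|M. W x * q x ^ n) * w ^ n) sums (LINT x|M. W x / (1 - q x * w))"
proof -
  have [measurable]: "W \<in> borel_measurable M" using W by simp
  have qw: "norm (q x * w) < 1" if "x \<in> space M" for x
    using q(2)[OF that] w mult_left_le_one_le[of "norm w" "norm (q x)"] by (simp add: norm_mult)
  have q_le: "norm (q x * w) ^ n \<le> norm w ^ n" if "x \<in> space M" for x n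
    using q(2)[OF that] by (intro power_mono) (auto simp: norm_mult mult_left_le_one_le)
  let ?f = "\<lambda>n x. W x * (q x * w) ^ n"
  have bound: "norm (?f n x) \<le> norm (norm w ^ n * norm (W x))" if "x \<in> space M" for n x
    using mult_left_mono[OF q_le[OF that, of n], of "norm (W x)"]
    by (simp add: norm_mult norm_power mult_ac)
  have int_w: "integrable M (\<lambda>x. norm w ^ n * norm (W x))" for n
    using W by simp
  have int: "integrable M (?f n)" for n
    by (rule Bochner_Integration.integrable_bound[OF int_w[of n]]) (use bound in auto)
  have "(\<lambda>n. integral\<^sup>L M (?f n)) sums (LINT x|M. (\<Sum>n. ?f n x))"
  proof (rule sums_integral[OF int])
    show "AE x in M. summable (\<lambda>n. norm (?f n x))"
      using qw by (intro AE_I2) (simp add: norm_mult norm_power summable_geometric flip: power_mult_distrib)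
    show "summable (\<lambda>n. LINT x|M. norm (?f n x))"
    proof (rule summable_comparison_test)
      show "summable (\<lambda>n. norm w ^ n * (LINT x|M. norm (W x)))"
        using w by (intro summable_mult2 summable_geometric) simp
      have "(LINT x|M. norm (?f n x)) \<le> (LINT x|M. norm w ^ n * norm (W x))" for n
        using int bound int_w by (intro integral_mono) auto
      then show "\<exists>N. \<forall>n\<ge>N. norm (LINT x|M. norm (?f n x)) \<le> norm w ^ n * (LINT x|M. norm (W x))"
        by simp
    qed
  qed
  also have "(LINT x|M. (\<Sum>n. ?f n x)) = (LINT x|M. W x / (1 - q x * w))"
  proof (rule Bochner_Integration.integral_cong[OF refl])
    fix x assume "x \<in> space M"
    from sums_mult[OF geometric_sums[OF qw[OF this]], of "W x"]
    show "(\<Sum>n. ?f n x) = W x / (1 - q x * w)"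
      by (simp add: sums_iff)
  qed
  also have "(\<lambda>n. integral\<^sup>L M (?f n)) = (\<lambda>n. (LINT x|M. W x * q x ^ n) * w ^ n)"
    by (simp add: power_mult_distrib flip: integral_mult_left_zero mult.assoc)
  finally show ?thesis .
qed

lemma power_series_zero:
  fixes a :: "nat \<Rightarrow> complex" and f :: "complex \<Rightarrow> complex"
  assumes sums: "\<And>z. norm z < 1 \<Longrightarrow> (\<lambda>n. a n * z ^ n) sums f z"
    and U: "U \<subseteq> ball 0 1" "\<xi> \<in> ball 0 1" "\<xi> islimpt U" "\<And>z. z \<in> U \<Longrightarrow> f z = 0"
  shows "norm z < 1 \<Longrightarrow> f z = 0" "a n = 0"
proof -
  have "f holomorphic_on ball 0 1"
    by (rule power_series_holomorphic[where a = a]) (use sums in auto)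
  then have zero: "f z = 0" if "norm z < 1" for z
    by (rule analytic_continuation[where U = U and \<xi> = \<xi>]) (use U that in auto)
  show "norm z < 1 \<Longrightarrow> f z = 0" by (rule zero)
  \<comment> \<open>The constant coefficient is \<open>f 0\<close>; isolation of a zero at 0 is then
    applied with a positive index.\<close>
  have a0: "a 0 = 0"
    using sums[of 0] zero[of 0] by simp
  show "a n = 0"
  proof (rule ccontr)
    assume "a n \<noteq> 0"
    then have "n > 0" using a0 by (cases n) auto
    obtain s where s: "0 < s" "\<And>z. z \<in> cball 0 s - {0} \<Longrightarrow> f z \<noteq> 0"
      using powser_0_nonzero[of 1 0 a f n] sums zero \<open>a n \<noteq> 0\<close> \<open>n > 0\<close> by auto
    \<comment> \<open>A nonzero point that lies both in the punctured disc without zeros and in the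
      unit disc, where \<open>f\<close> is 0.\<close>
    define z where "z = complex_of_real (min s (1 / 2))"
    have "norm z < 1" "z \<in> cball 0 s - {0}"
      using s(1) by (auto simp: z_def)
    with s zero show False by blast
  qed
qed

text \<open>Uniqueness in the Hausdorff moment problem, for the image under \<open>u\<close> of the
  complex measure with density \<open>W\<close>. Vanishing passes from polynomials to continuous
  functions by Weierstrass, to closed sets by dominated convergence, and to Borel sets by Dynkin
  induction.\<close>

lemma integrable_zero_of_moments_zero:
  fixes W :: "'a \<Rightarrow> complex" and u :: "'a \<Rightarrow> real"
  assumes W: "integrable M W" and u[measurable]: "u \<in> borel_measurable M"
    and u01: "\<And>x. x \<in> space M \<Longrightarrow> u x \<in> {0..1}"
    and mom: "\<And>n. (LINT x|M. W x * of_real (u x) ^ n) = 0"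
    and B: "B \<in> sets borel"
  shows "(LINT x|M. W x * of_real (indicator B (u x))) = 0"
proof -
  have [measurable]: "W \<in> borel_measurable M" using W by simp
  have int: "integrable M (\<lambda>x. W x * of_real (h (u x)))"
    if [measurable]: "h \<in> borel_measurable borel" and "\<And>y. y \<in> {0..1} \<Longrightarrow> \<bar>h y\<bar> \<le> c" for h c
  proof (rule Bochner_Integration.integrable_bound)
    show "integrable M (\<lambda>x. c * norm (W x))" using W by simp
    show "AE x in M. norm (W x * complex_of_real (h (u x))) \<le> norm (c * norm (W x))"
    proof (rule AE_I2)
      fix x assume "x \<in> space M"
      from that(2)[OF u01[OF this]] have "\<bar>h (u x)\<bar> \<le> \<bar>c\<bar>" by linarith
      from mult_left_mono[OF this, of "norm (W x)"]
      show "norm (W x * complex_of_real (h (u x))) \<le> norm (c * norm (W x))"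
        by (simp add: norm_mult abs_mult mult.commute)
    qed
  qed simp
  have poly: "(LINT x|M. W x * of_real (h (u x))) = 0" if h: "real_polynomial_function h" for h
  proof -
    obtain a n where h: "h = (\<lambda>x. \<Sum>i\<le>n. a i * x ^ i)"
      using h unfolding real_polynomial_function_iff_sum by blast
    have "integrable M (\<lambda>x. W x * of_real (u x ^ i))" for i
      by (rule int[where h = "\<lambda>y. y ^ i" and c = 1]) (auto intro: power_le_one simp: power_abs)
    then have i: "integrable M (\<lambda>x. of_real (a i) * (W x * of_real (u x) ^ i))" for i
      by simp
    have "(LINT x|M. W x * of_real (h (u x))) = (LINT x|M. (\<Sum>i\<le>n. of_real (a i) * (W x * of_real (u x) ^ i)))"
      by (simp add: h sum_distrib_left mult_ac)
    also have "\<dots> = (\<Sum>i\<le>n. (LINT x|M. of_real (a i) * (W x * of_real (u x) ^ i)))"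
      using i by (rule Bochner_Integration.integral_sum)
    also have "\<dots> = 0"
      by (simp add: mom)
    finally show ?thesis .
  qed
  have cont: "(LINT x|M. W x * of_real (h (u x))) = 0" if h: "continuous_on UNIV h" for h
  proof (rule ccontr)
    let ?I = "LINT x|M. W x * of_real (h (u x))"
    assume "?I \<noteq> 0"
    define K where "K = (LINT x|M. norm (W x))"
    have K: "K \<ge> 0" unfolding K_def by simp
    \<comment> \<open>The error is at most \<open>e * K\<close>, strictly below
      \<open>e * (K + 1) = norm ?I\<close>; the added 1 also covers \<open>K = 0\<close>.\<close>
    define e where "e = norm ?I / (K + 1)"
    have "e > 0" using \<open>?I \<noteq> 0\<close> K by (simp add: e_def)
    have h01: "continuous_on {0..1} h" using h by (rule continuous_on_subset) simp
    obtain g where g: "real_polynomial_function g" "\<And>y. y \<in> {0..1} \<Longrightarrow> \<bar>h y - g y\<bar> < e"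
      using Stone_Weierstrass_real_polynomial_function[OF compact_Icc h01 \<open>e > 0\<close>] by blast
    have hm: "h \<in> borel_measurable borel" using h by (rule borel_measurable_continuous_onI)
    have "continuous_on UNIV g"
      using g(1) by (simp add: continuous_on_polymonial_function real_polynomial_function_eq)
    then have gm: "g \<in> borel_measurable borel" by (rule borel_measurable_continuous_onI)
    have dm: "(\<lambda>y. h y - g y) \<in> borel_measurable borel" using hm gm by simp
    have bounded: "\<exists>c. \<forall>y\<in>{0..1}. \<bar>h y\<bar> \<le> c"
      using compact_imp_bounded[OF compact_continuous_image[OF h01 compact_Icc]]
      by (auto simp: bounded_iff)
    then obtain c where c: "\<And>y. y \<in> {0..1} \<Longrightarrow> \<bar>h y\<bar> \<le> c" by blast
    have ih: "integrable M (\<lambda>x. W x * of_real (h (u x)))"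
      by (rule int[OF hm c])
    have id: "integrable M (\<lambda>x. W x * of_real (h (u x) - g (u x)))"
      by (rule int[OF dm, where c = e]) (use g(2) in force)
    have "integrable M (\<lambda>x. W x * of_real (h (u x)) - W x * of_real (h (u x) - g (u x)))"
      by (rule Bochner_Integration.integrable_diff[OF ih id])
    then have ig: "integrable M (\<lambda>x. W x * of_real (g (u x)))"
      by (simp add: algebra_simps)
    have "?I = ?I - (LINT x|M. W x * of_real (g (u x)))"
      by (simp add: poly[OF g(1)])
    also have "\<dots> = (LINT x|M. W x * of_real (h (u x) - g (u x)))"
      by (subst Bochner_Integration.integral_diff[OF ih ig, symmetric]) (simp add: algebra_simps)
    finally have "norm ?I \<le> (LINT x|M. norm (W x * of_real (h (u x) - g (u x))))"
      using integral_norm_bound[of M "\<lambda>x. W x * of_real (h (u x) - g (u x))"] by simp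
    also have "\<dots> \<le> (LINT x|M. e * norm (W x))"
    proof (rule integral_mono)
      fix x assume "x \<in> space M"
      from mult_left_mono[OF less_imp_le[OF g(2)[OF u01[OF this]]], of "norm (W x)"]
      show "norm (W x * of_real (h (u x) - g (u x))) \<le> e * norm (W x)"
        by (simp add: norm_mult mult.commute flip: of_real_diff)
    qed (use id W in auto)
    also have "\<dots> = e * K" by (simp add: K_def)
    also have "\<dots> < e * (K + 1)" using \<open>e > 0\<close> by simp
    also have "\<dots> = norm ?I" using K by (simp add: e_def)
    finally show False by simp
  qed
  have closed: "(LINT x|M. W x * of_real (indicator C (u x))) = 0" if C: "closed C" for C
  proof (cases "C = {}")
    case False
    \<comment> \<open>Continuous functions that equal 1 on \<open>C\<close> and vanish at distance
      \<open>1 / n\<close> or more from it, hence converge pointwise to the indicator of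
      \<open>C\<close>.\<close>
    define h where "h n y = max 0 (1 - real n * infdist y C)" for n y
    have hc: "continuous_on UNIV (h n)" for n
      unfolding h_def by (intro continuous_intros)
    then have [measurable]: "h n \<in> borel_measurable borel" for n
      by (rule borel_measurable_continuous_onI)
    have [measurable]: "C \<in> sets borel" using C by simp
    have "(\<lambda>n. LINT x|M. W x * of_real (h n (u x))) \<longlonglongrightarrow> (LINT x|M. W x * of_real (indicator C (u x)))"
    proof (rule integral_dominated_convergence[where w = "\<lambda>x. norm (W x)"])
      have "(\<lambda>n. h n y) \<longlonglongrightarrow> indicator C y" for y
      proof (cases "y \<in> C")
        case True
        then show ?thesis by (simp add: h_def)
      next
        case False
        then have d: "infdist y C > 0"
          using in_closed_iff_infdist_zero[OF C \<open>C \<noteq> {}\<close>] infdist_nonneg[of y C] by auto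
        obtain N where N: "1 < real N * infdist y C"
          using reals_Archimedean3[OF d] by blast
        have "h n y = 0" if "n \<ge> N" for n
        proof -
          have "real N * infdist y C \<le> real n * infdist y C"
            using that d by (intro mult_right_mono) auto
          with N show ?thesis unfolding h_def by linarith
        qed
        then have "eventually (\<lambda>n. h n y = indicator C y) sequentially"
          using False by (auto simp: eventually_sequentially)
        then show ?thesis by (rule tendsto_eventually)
      qed
      then show "AE x in M. (\<lambda>n. W x * complex_of_real (h n (u x))) \<longlonglongrightarrow> W x * complex_of_real (indicator C (u x))"
        by (intro AE_I2 tendsto_intros)
      have "\<bar>h n y\<bar> \<le> 1" for n y
        by (auto simp: h_def infdist_nonneg)
      then show "AE x in M. norm (W x * complex_of_real (h n (u x))) \<le> norm (W x)" for n
        by (intro AE_I2) (simp add: norm_mult mult_left_le)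
    qed (use W in auto)
    then show ?thesis
      by (simp add: cont[OF hc] LIMSEQ_const_iff)
  qed simp
  have ind: "integrable M (\<lambda>x. W x * of_real (indicator B (u x)))" if [measurable]: "B \<in> sets borel" for B
    by (rule int[where c = 1]) (auto simp: indicator_def)
  have "Int_stable (Collect (closed :: real set \<Rightarrow> bool))"
    by (auto simp: Int_stable_def)
  moreover have "Collect (closed :: real set \<Rightarrow> bool) \<subseteq> Pow UNIV" by simp
  moreover have borel: "sets (borel :: real measure) = sigma_sets UNIV (Collect closed)"
    by (simp add: borel_eq_closed)
  then have "B \<in> sigma_sets UNIV (Collect closed)" using B by simp
  ultimately show ?thesis
  proof (induction rule: sigma_sets_induct_disjoint)
    case (basic A)
    then show ?case using closed by simp
  next
    case empty
    show ?case by simp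
  next
    case (compl A)
    then have A: "A \<in> sets borel" by (simp add: borel)
    \<comment> \<open>The total integral vanishes as the closed case for
      \<open>UNIV\<close>.\<close>
    have eq: "W x * of_real (indicator (UNIV - A) (u x)) =
        W x * of_real (indicator UNIV (u x)) - W x * of_real (indicator A (u x))" for x
      by (simp add: indicator_def)
    show ?case
      unfolding eq using compl(2) closed[of UNIV]
      by (subst Bochner_Integration.integral_diff[OF ind[of UNIV] ind[OF A]]) auto
  next
    case (union A)
    then have A: "A i \<in> sets borel" for i by (auto simp: borel)
    have UA: "(\<Union>i. A i) \<in> sets borel" using A by auto
    have "(\<lambda>n. LINT x|M. W x * of_real (indicator (\<Union>i<n. A i) (u x))) \<longlonglongrightarrow>
        (LINT x|M. W x * of_real (indicator (\<Union>i. A i) (u x)))"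
    proof (rule integral_dominated_convergence[where w = "\<lambda>x. norm (W x)"])
      have "(\<lambda>n. indicator (\<Union>i<n. A i) y :: real) \<longlonglongrightarrow> indicator (\<Union>i. A i) y" for y
        by (rule LIMSEQ_indicator_UN)
      then show "AE x in M. (\<lambda>n. W x * complex_of_real (indicator (\<Union>i<n. A i) (u x))) \<longlonglongrightarrow>
          W x * complex_of_real (indicator (\<Union>i. A i) (u x))"
        by (intro AE_I2 tendsto_intros)
      show "AE x in M. norm (W x * complex_of_real (indicator (\<Union>i<n. A i) (u x))) \<le> norm (W x)" for n
        by (intro AE_I2) (simp add: indicator_def)
    qed (use W A UA ind in auto)
    moreover have "(LINT x|M. W x * of_real (indicator (\<Union>i<n. A i) (u x))) = 0" for n
    proof -
      have "indicator (\<Union>i<n. A i) y = (\<Sum>i<n. indicator (A i) y :: real)" for y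
        using union(1) by (intro indicator_UN_disjoint) (auto simp: disjoint_family_on_def)
      then have "(LINT x|M. W x * of_real (indicator (\<Union>i<n. A i) (u x))) =
         (LINT x|M. (\<Sum>i<n. W x * of_real (indicator (A i) (u x))))"
        by (simp add: sum_distrib_left)
      also have "\<dots> = 0"
        using union(3) by (subst Bochner_Integration.integral_sum) (use ind[OF A] in auto)
      finally show ?thesis .
    qed
    ultimately show ?case
      by (simp add: LIMSEQ_const_iff)
  qed
qed

text \<open>
  The transform vanishes near \<open>1\<close> by a power series in \<open>1 - z\<close>, hence near \<open>\<i>\<close> by one in \<open>\<i> - z\<close>.  The
  coefficients of the latter are the moments of a finite complex measure in \<open>u = 1 / (1 + \<tau>)\<close>.
\<close>

lemma stieltjes_transform_zero_imp_AE_zero: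
  fixes E :: "real \<Rightarrow> complex"
  assumes int: "set_integrable lborel {0<..} (\<lambda>\<tau>. E \<tau> / (1 + \<i> * of_real \<tau>))"
    and zero: "\<And>x. x > 0 \<Longrightarrow> (LINT \<tau>:{0<..}|lborel. E \<tau> / (of_real x + \<i> * of_real \<tau>)) = 0"
  shows "AE \<tau> in lborel. \<tau> > 0 \<longrightarrow> E \<tau> = 0"
proof -
  define M where "M = restrict_space lborel {0::real<..}"
  have spM: "space M = {0<..}" by (simp add: M_def space_restrict_space)
  have LM: "integral\<^sup>L M f = (LINT \<tau>:{0<..}|lborel. f \<tau>)" for f :: "real \<Rightarrow> complex"
    unfolding M_def set_lebesgue_integral_def by (rule integral_restrict_space) simp
  have meas: "f \<in> borel_measurable M" if "f \<in> borel_measurable borel" for f :: "real \<Rightarrow> 'b::topological_space"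
    unfolding M_def using that by (intro measurable_restrict_space1) simp
  have nz1: "1 + \<i> * complex_of_real \<tau> \<noteq> 0" for \<tau> by (simp add: complex_eq_iff)
  have nz2: "\<i> + \<i> * complex_of_real \<tau> \<noteq> 0" if "\<tau> > 0" for \<tau> using that by (simp add: complex_eq_iff)
  define W1 where "W1 \<tau> = E \<tau> / (1 + \<i> * of_real \<tau>)" for \<tau>
  have W1: "integrable M W1"
    using int unfolding M_def W1_def set_integrable_def by (subst integrable_restrict_space) simp_all
  define S where "S z = (LINT \<tau>|M. E \<tau> / (z + \<i> * of_real \<tau>))" for z
  define q1 where "q1 \<tau> = 1 / (1 + \<i> * complex_of_real \<tau>)" for \<tau>
  have q1: "q1 \<in> borel_measurable M"
    unfolding q1_def by (intro meas borel_measurable_continuous_onI continuous_intros) (simp add: nz1)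
  have q1_le: "norm (q1 \<tau>) \<le> 1" for \<tau>
    using complex_Re_le_cmod[of "1 + \<i> * \<tau>"] by (simp add: q1_def norm_divide divide_le_eq_1)
  have "W1 \<tau> / (1 - q1 \<tau> * w) = E \<tau> / (1 - w + \<i> * of_real \<tau>)" for \<tau> w
  proof -
    have "1 - q1 \<tau> * w = (1 - w + \<i> * of_real \<tau>) / (1 + \<i> * of_real \<tau>)"
      using nz1[of \<tau>] by (simp add: q1_def field_simps)
    then show ?thesis using nz1[of \<tau>] by (simp add: W1_def)
  qed
  with power_series_moments[OF W1 q1 q1_le]
  have sums1: "(\<lambda>n. (LINT \<tau>|M. W1 \<tau> * q1 \<tau> ^ n) * w ^ n) sums S (1 - w)" if "norm w < 1" for w
    using that by (simp add: S_def)
  have S1: "S (1 - w) = 0" if "norm w < 1" for w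
  proof (rule power_series_zero(1)[OF sums1 _ _ _ _ that])
    show "0 islimpt complex_of_real ` {0<..<1}"
      unfolding islimpt_approachable
    proof (intro allI impI)
      fix e :: real assume "e > 0"
      then show "\<exists>x'\<in>complex_of_real ` {0<..<1}. x' \<noteq> 0 \<and> dist x' 0 < e"
        by (intro bexI[of _ "complex_of_real (min (1 / 2) (e / 2))"]) auto
    qed
    \<comment> \<open>For \<open>0 < r < 1\<close> the point \<open>1 - r\<close> is a positive
      real, where the transform vanishes by assumption.\<close>
    show "S (1 - z) = 0" if z: "z \<in> complex_of_real ` {0<..<1}" for z
    proof -
      obtain r where r: "z = of_real r" "0 < r" "r < 1" using z by auto
      have "S (of_real (1 - r)) = 0"
        unfolding S_def LM by (rule zero) (use r in simp)
      then show ?thesis by (simp add: r)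
    qed
  qed auto
  \<comment> \<open>At the base point \<open>\<i>\<close> the expansion function
    \<open>1 / (\<i> + \<i> * \<tau>)\<close> is \<open>- \<i>\<close> times a real number, so the
    coefficients are moments of a real variable. At the base point 1 it is
    \<open>1 / (1 + \<i> * \<tau>)\<close>, which has no such form.\<close>
  define W2 where "W2 \<tau> = E \<tau> / (\<i> + \<i> * of_real \<tau>)" for \<tau>
  \<comment> \<open>The absolute value makes \<open>u\<close> continuous with values in
    \<open>{0..1}\<close> on the whole line; for \<open>\<tau> > 0\<close> it is
    \<open>1 / (1 + \<tau>)\<close>.\<close>
  define u where "u \<tau> = 1 / (1 + \<bar>\<tau>\<bar>)" for \<tau> :: real
  define q2 where "q2 \<tau> = - \<i> * complex_of_real (u \<tau>)" for \<tau>
  have um: "u \<in> borel_measurable M"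
    unfolding u_def by (intro meas borel_measurable_continuous_onI continuous_intros) auto
  have q2: "q2 \<in> borel_measurable M"
    unfolding q2_def using um by simp
  have q2_le: "norm (q2 \<tau>) \<le> 1" for \<tau>
    unfolding q2_def norm_mult norm_minus_cancel norm_ii norm_of_real by (simp add: u_def)
  have q2_eq: "q2 \<tau> = 1 / (\<i> + \<i> * of_real \<tau>)" if "\<tau> > 0" for \<tau>
    using that nz2[OF that] by (simp add: q2_def u_def field_simps flip: of_real_add) (simp add: complex_eq_iff field_simps)
  have W2_eq: "W2 \<tau> = W1 \<tau> * ((1 + \<i> * of_real \<tau>) / (\<i> + \<i> * of_real \<tau>))" for \<tau>
    using nz1[of \<tau>] by (simp add: W1_def W2_def)
  have W2: "integrable M W2"
  proof (rule Bochner_Integration.integrable_bound[OF W1])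
    have "(\<lambda>\<tau>. 1 + \<i> * complex_of_real \<tau>) \<in> borel_measurable M" "(\<lambda>\<tau>. \<i> + \<i> * complex_of_real \<tau>) \<in> borel_measurable M"
      by (intro meas borel_measurable_continuous_onI continuous_intros)+
    then have "(\<lambda>\<tau>. W1 \<tau> * ((1 + \<i> * of_real \<tau>) / (\<i> + \<i> * of_real \<tau>))) \<in> borel_measurable M"
      using W1 by simp
    then show "W2 \<in> borel_measurable M" by (simp add: W2_eq[abs_def])
    show "AE \<tau> in M. norm (W2 \<tau>) \<le> norm (W1 \<tau>)"
    proof (rule AE_I2)
      fix \<tau> assume "\<tau> \<in> space M"
      then have \<tau>: "\<tau> > 0" by (simp add: spM)
      have "norm (1 + \<i> * complex_of_real \<tau>) \<le> norm (\<i> + \<i> * complex_of_real \<tau>)"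
        using \<tau> by (simp add: cmod_def power2_eq_square algebra_simps)
      then have "norm ((1 + \<i> * complex_of_real \<tau>) / (\<i> + \<i> * of_real \<tau>)) \<le> 1"
        using nz2[OF \<tau>] by (simp add: norm_divide)
      then show "norm (W2 \<tau>) \<le> norm (W1 \<tau>)"
        unfolding W2_eq norm_mult by (intro mult_left_le) auto
    qed
  qed
  have "S (\<i> - w) = (LINT \<tau>|M. W2 \<tau> / (1 - q2 \<tau> * w))" for w
    unfolding S_def
  proof (rule Bochner_Integration.integral_cong[OF refl])
    fix \<tau> assume "\<tau> \<in> space M"
    then have \<tau>: "\<tau> > 0" by (simp add: spM)
    have "1 - q2 \<tau> * w = (\<i> - w + \<i> * of_real \<tau>) / (\<i> + \<i> * of_real \<tau>)"
      using nz2[OF \<tau>] by (simp add: q2_eq[OF \<tau>] field_simps)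
    then show "E \<tau> / (\<i> - w + \<i> * of_real \<tau>) = W2 \<tau> / (1 - q2 \<tau> * w)"
      using nz2[OF \<tau>] by (simp add: W2_def)
  qed
  with power_series_moments[OF W2 q2 q2_le]
  have sums2: "(\<lambda>n. (LINT \<tau>|M. W2 \<tau> * q2 \<tau> ^ n) * w ^ n) sums S (\<i> - w)" if "norm w < 1" for w
    using that by simp
  have mom: "(LINT \<tau>|M. W2 \<tau> * q2 \<tau> ^ n) = 0" for n
  proof (rule power_series_zero(2)[OF sums2])
    \<comment> \<open>Overlap of the unit discs about \<open>\<i>\<close> and 1, in the coordinate
      \<open>w\<close> of the point \<open>\<i> - w\<close>. The midpoint
      \<open>(\<i> - 1) / 2\<close> has distance \<open>sqrt 2 / 2\<close> from both
      centres.\<close>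
    let ?U = "ball 0 1 \<inter> ball (\<i> - 1) 1 :: complex set"
    have "norm ((\<i> - 1) / 2) < 1" "norm ((\<i> - 1) - (\<i> - 1) / 2) < 1"
      by (auto simp: cmod_def power2_eq_square real_sqrt_lt_1_iff)
    then have \<xi>: "(\<i> - 1) / 2 \<in> ?U" by (auto simp: dist_norm)
    then show "(\<i> - 1) / 2 \<in> ball 0 1" by blast
    show "(\<i> - 1) / 2 islimpt ?U"
      using \<xi> by (intro interior_limit_point) (simp add: interior_open)
    show "S (\<i> - z) = 0" if "z \<in> ?U" for z
      using S1[of "1 - (\<i> - z)"] that by (simp add: dist_norm norm_minus_commute algebra_simps)
  qed auto
  have mom': "(LINT \<tau>|M. W2 \<tau> * of_real (u \<tau>) ^ n) = 0" for n
  proof -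
    have "W2 \<tau> * q2 \<tau> ^ n = (- \<i>) ^ n * (W2 \<tau> * of_real (u \<tau>) ^ n)" for \<tau>
      unfolding q2_def power_mult_distrib by (simp add: mult_ac)
    with mom[of n] have "(- \<i>) ^ n * (LINT \<tau>|M. W2 \<tau> * of_real (u \<tau>) ^ n) = 0"
      by simp
    then show ?thesis by simp
  qed
  have "AE \<tau> in M. W2 \<tau> = 0"
  proof (rule sigma_finite_measure.density_zero[OF _ W2])
    show "sigma_finite_measure M"
      unfolding M_def by (rule sigma_finite_measure_restrict_space[OF sigma_finite_lborel]) simp
  next
    fix A assume "A \<in> sets M"
    then have A: "A \<in> sets borel" by (simp add: M_def sets_restrict_space_iff)
    \<comment> \<open>\<open>1 / y - 1\<close> inverts \<open>u\<close> on positive arguments, so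
      \<open>u \<tau> \<in> B\<close> means \<open>\<tau> \<in> A\<close> there.\<close>
    define B where "B = (\<lambda>y. 1 / y - 1) -` A"
    have "(\<lambda>y::real. 1 / y - 1) \<in> borel_measurable borel" by measurable
    from measurable_sets[OF this A] have B: "B \<in> sets borel" by (simp add: B_def)
    have u01: "u \<tau> \<in> {0..1}" for \<tau> by (simp add: u_def)
    have "set_lebesgue_integral M A W2 = (LINT \<tau>|M. W2 \<tau> * of_real (indicator B (u \<tau>)))"
      unfolding set_lebesgue_integral_def
      by (rule Bochner_Integration.integral_cong[OF refl])
        (auto simp: spM u_def B_def indicator_def)
    also have "\<dots> = 0"
      by (rule integrable_zero_of_moments_zero[OF W2 um u01 mom' B])
    finally show "set_lebesgue_integral M A W2 = 0" .
  qed
  then have "AE \<tau> in lborel. \<tau> \<in> {0<..} \<longrightarrow> W2 \<tau> = 0"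
    unfolding M_def by (subst (asm) AE_restrict_space_iff) auto
  then show ?thesis
    by eventually_elim (use nz2 in \<open>auto simp: W2_def\<close>)
qed

section \<open>Almost everywhere equal functions\<close>

lemma set_borel_measurable_mult:
  fixes f g :: "'a \<Rightarrow> complex"
  assumes "set_borel_measurable M A f" "set_borel_measurable M A g"
  shows "set_borel_measurable M A (\<lambda>x. f x * g x)"
proof -
  have eq: "(\<lambda>x. indicator A x *\<^sub>R (f x * g x)) = (\<lambda>x. (indicator A x *\<^sub>R f x) * (indicator A x *\<^sub>R g x))"
    by (auto simp: indicator_def)
  show ?thesis
    using assms unfolding set_borel_measurable_def eq by (rule borel_measurable_times)
qed

lemma set_borel_measurable_lborel_continuous:
  assumes "continuous_on {0<..} f"
  shows "set_borel_measurable lborel {0<..} (f :: real \<Rightarrow> complex)"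
  using borel_measurable_continuous_on_indicator[OF _ assms] by (simp add: set_borel_measurable_def)

text \<open>Since \<open>lborel\<close> is not complete, equality almost everywhere does not carry
  measurability along, which is why it is assumed for both functions.\<close>

lemma set_integral_AE_transfer:
  fixes f g w :: "real \<Rightarrow> complex"
  assumes ae: "AE t in lborel. t > 0 \<longrightarrow> f t = g t"
    and m: "set_borel_measurable lborel {0<..} f" "set_borel_measurable lborel {0<..} g"
      "set_borel_measurable lborel {0<..} w"
    and A: "A \<in> sets borel" "A \<subseteq> {0<..}"
  shows "set_integrable lborel A (\<lambda>t. w t * f t) \<longleftrightarrow> set_integrable lborel A (\<lambda>t. w t * g t)"
    and "(LINT t:A|lborel. w t * f t) = (LINT t:A|lborel. w t * g t)"
proof -
  have meas: "(\<lambda>t. indicator A t *\<^sub>R (w t * h t)) \<in> borel_measurable lborel"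
    if h: "set_borel_measurable lborel {0<..} h" for h
  proof -
    have "(\<lambda>t. indicator A t *\<^sub>R (indicator {0<..} t *\<^sub>R (w t * h t))) \<in> borel_measurable lborel"
      by (rule borel_measurable_scaleR[OF _ set_borel_measurable_mult[OF m(3) h, unfolded set_borel_measurable_def]])
        (use A in simp)
    also have "(\<lambda>t. indicator A t *\<^sub>R (indicator {0<..} t *\<^sub>R (w t * h t))) = (\<lambda>t. indicator A t *\<^sub>R (w t * h t))"
      using A by (auto simp: indicator_def fun_eq_iff)
    finally show ?thesis .
  qed
  have ae': "AE t in lborel. indicator A t *\<^sub>R (w t * f t) = indicator A t *\<^sub>R (w t * g t)"
    using ae by eventually_elim (use A in \<open>auto simp: indicator_def\<close>)
  show "set_integrable lborel A (\<lambda>t. w t * f t) \<longleftrightarrow> set_integrable lborel A (\<lambda>t. w t * g t)"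
    unfolding set_integrable_def by (rule integrable_cong_AE[OF meas meas ae']) (use m in auto)
  show "(LINT t:A|lborel. w t * f t) = (LINT t:A|lborel. w t * g t)"
    unfolding set_lebesgue_integral_def by (rule integral_cong_AE[OF meas meas ae']) (use m in auto)
qed

text \<open>The representation determines a spectrum only up to null sets. Both kinds of Mellin
  transform see the function only through integrals against continuous weights: powers, test
  functions and the constant 1.\<close>

lemma has_mellin_AE_transfer:
  assumes ae: "AE t in lborel. t > 0 \<longrightarrow> f t = g t"
    and m: "set_borel_measurable lborel {0<..} f" "set_borel_measurable lborel {0<..} g"
    and F: "has_mellin f F"
  shows "has_mellin g F"
proof -
  have w: "set_borel_measurable lborel {0<..} (\<lambda>t. complex_of_real t powr (s - 1))" for s
    by (intro set_borel_measurable_lborel_continuous continuous_intros) auto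
  note tr = set_integral_AE_transfer[OF ae m]
  have "mellin_integrable_on {0<..<1} f = mellin_integrable_on {0<..<1} g"
    "mellin_on {0<..<1} f = mellin_on {0<..<1} g"
    "mellin_integrable_on {1..} f = mellin_integrable_on {1..} g"
    "mellin_on {1..} f = mellin_on {1..} g"
    unfolding mellin_integrable_on_def mellin_on_def fun_eq_iff
    by (intro allI tr[OF w]; force)+
  then have c: "has_continued_mellin f F = has_continued_mellin g F"
    unfolding has_continued_mellin_def by simp
  have loc: "set_integrable lborel {a..b} f = set_integrable lborel {a..b} g" if "a > 0" for a b
  proof -
    have "{a..b} \<subseteq> {0<..}" using that by auto
    from tr(1)[OF set_borel_measurable_lborel_continuous[OF continuous_on_const[of _ 1]] _ this] show ?thesis
      by simp
  qed
  have "dist_of f h = dist_of g h" if "test_function h" for h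
    using tr(2)[OF set_borel_measurable_lborel_continuous[OF test_function_continuous[OF that]], of "{0<..}"]
    by (simp add: dist_of_def mult.commute)
  then have "dist_mellin_is_function (dist_of f) c F = dist_mellin_is_function (dist_of g) c F" for c
    unfolding dist_mellin_is_function_def by auto
  with loc have d: "has_distributional_mellin f F = has_distributional_mellin g F"
    unfolding has_distributional_mellin_def by auto
  show ?thesis
    using F by (simp add: has_mellin_def c d)
qed

lemma power_minus_const_not_has_mellin:
  fixes C D :: complex and p :: real
  assumes "C \<noteq> 0" "p \<noteq> 0" "\<And>t. t > 0 \<Longrightarrow> f t = C * of_real t powr of_real p - D"
    and "countable {s. F s = 0}"
  shows "\<not> has_mellin f F"
  using power_minus_const_dist_mellin_not_function[OF assms(1-3)]
    continued_mellin_power_minus_const_zero[OF assms(3)] countable_zeros_not_cosparse_zero[OF assms(4)]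
  unfolding has_mellin_def has_distributional_mellin_def by blast

section \<open>The spectrum of a power law\<close>

text \<open>The substitution \<open>u = \<omega> * \<tau>\<close> extracts the power of
  \<open>\<omega>\<close>. The integrand \<open>\<phi>\<close> is bounded by
  \<open>u powr (- \<beta>)\<close> near 0, integrable as \<open>\<beta> < 1\<close>, and by
  \<open>u powr (- \<beta> - 1)\<close> near infinity, integrable as \<open>\<beta> > 0\<close>. Its
  real part is positive, hence \<open>\<kappa> \<noteq> 0\<close>.\<close>

lemma power_spectrum_integral:
  fixes \<beta> :: real
  assumes \<beta>: "0 < \<beta>" "\<beta> < 1"
  obtains \<kappa> :: complex where "\<kappa> \<noteq> 0"
    "\<And>\<omega>. \<omega> > 0 \<Longrightarrow> set_integrable lborel {0<..}
       (\<lambda>\<tau>. \<i> * of_real (\<omega> * \<tau>) / (1 + \<i> * of_real (\<omega> * \<tau>)) * of_real \<tau> powr of_real (- \<beta>) / of_real \<tau>)"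
    "\<And>\<omega>. \<omega> > 0 \<Longrightarrow> (LINT \<tau>:{0<..}|lborel.
       \<i> * of_real (\<omega> * \<tau>) / (1 + \<i> * of_real (\<omega> * \<tau>)) * of_real \<tau> powr of_real (- \<beta>) / of_real \<tau>) =
       \<kappa> * of_real \<omega> powr of_real \<beta>"
proof
  define \<phi> where "\<phi> u = \<i> * of_real u / (1 + \<i> * of_real u) * of_real u powr of_real (- \<beta>) / complex_of_real u" for u
  have nz: "1 + \<i> * complex_of_real u \<noteq> 0" for u by (simp add: complex_eq_iff)
  have powr: "complex_of_real u powr of_real (- \<beta>) = of_real (u powr (- \<beta>))" if "u > 0" for u
    using powr_of_real[of u "- \<beta>"] that by simp
  have \<phi>: "\<phi> u = \<i> / (1 + \<i> * of_real u) * of_real (u powr (- \<beta>))" if "u > 0" for u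
  proof -
    have "\<i> * of_real u / d * r / of_real u = \<i> / d * r" for d r :: complex
      using that by (simp add: divide_simps)
    then show ?thesis unfolding \<phi>_def powr[OF that] .
  qed
  have "continuous_on {0<..} \<phi>"
    unfolding \<phi>_def using nz by (intro continuous_intros) auto
  then have m: "set_borel_measurable lborel {0<..} \<phi>"
    by (rule set_borel_measurable_lborel_continuous)
  have norm_le: "norm (\<phi> u) \<le> u powr (- \<beta>)" "norm (\<phi> u) \<le> u powr (- \<beta> - 1)" if "u > 0" for u
  proof -
    have "norm (\<phi> u) = u powr (- \<beta>) / norm (1 + \<i> * complex_of_real u)"
      using that by (simp add: \<phi> norm_mult norm_divide)
    moreover have "1 \<le> norm (1 + \<i> * complex_of_real u)" "u \<le> norm (1 + \<i> * complex_of_real u)"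
      using complex_Re_le_cmod[of "1 + \<i> * u"] abs_Im_le_cmod[of "1 + \<i> * u"] by auto
    moreover have "u powr (- \<beta> - 1) = u powr (- \<beta>) / u"
      using that by (simp add: powr_diff)
    ultimately show "norm (\<phi> u) \<le> u powr (- \<beta>)" "norm (\<phi> u) \<le> u powr (- \<beta> - 1)"
      using that divide_left_mono[of 1 "norm (1 + \<i> * complex_of_real u)" "u powr (- \<beta>)"]
        divide_left_mono[of u "norm (1 + \<i> * complex_of_real u)" "u powr (- \<beta>)"] nz[of u]
      by (simp_all add: zero_less_mult_iff)
  qed
  have i1: "set_integrable lborel {0<..<1} \<phi>"
  proof (rule set_integrable_bound)
    show "set_integrable lborel {0<..<1} (\<lambda>t. t powr ((1 - \<beta>) - 1))"
      using \<beta> by (intro set_integral_powr_0_1) simp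
    show "set_borel_measurable lborel {0<..<1} \<phi>"
      by (rule set_borel_measurable_subset[OF m]) auto
    show "AE t in lborel. t \<in> {0<..<1} \<longrightarrow> norm (\<phi> t) \<le> norm (t powr ((1 - \<beta>) - 1))"
      using norm_le by (intro AE_I2) auto
  qed
  have i2: "set_integrable lborel {1..} \<phi>"
  proof (rule set_integrable_bound)
    show "set_integrable lborel {1..} (\<lambda>t. t powr (- \<beta> - 1))"
      using \<beta> by (intro set_integral_powr_1_inf) simp
    show "set_borel_measurable lborel {1..} \<phi>"
      by (rule set_borel_measurable_subset[OF m]) auto
    show "AE t in lborel. t \<in> {1..} \<longrightarrow> norm (\<phi> t) \<le> norm (t powr (- \<beta> - 1))"
      using norm_le by (intro AE_I2) auto
  qed
  have "set_integrable lborel ({0<..<1} \<union> {1..}) \<phi>"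
    by (rule set_integrable_Un[OF i1 i2]) auto
  also have "{0<..<1} \<union> {1..} = {0::real<..}" by auto
  finally have int: "set_integrable lborel {0<..} \<phi>" .
  define \<kappa> where "\<kappa> = (LINT u:{0<..}|lborel. \<phi> u)"
  show "\<kappa> \<noteq> 0"
  proof
    assume "\<kappa> = 0"
    let ?r = "\<lambda>u. Re (indicator {0<..} u *\<^sub>R \<phi> u)"
    have r: "integrable lborel ?r"
      using int unfolding set_integrable_def by (rule integrable_Re)
    have pos: "Re (\<phi> u) > 0" if "u > 0" for u
    proof -
      have "Re (\<i> / (1 + \<i> * of_real u)) = u / (1 + u\<^sup>2)"
        by (simp add: Re_divide power2_eq_square)
      moreover have "1 + u\<^sup>2 > 0" using that by (simp add: add_pos_nonneg)
      moreover have "Re (\<phi> u) = Re (\<i> / (1 + \<i> * of_real u)) * u powr (- \<beta>)"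
        by (simp only: \<phi>[OF that] times_complex.sel Re_complex_of_real Im_complex_of_real mult_zero_right diff_zero)
      ultimately show ?thesis using that by simp
    qed
    have "integral\<^sup>L lborel ?r = Re \<kappa>"
      unfolding \<kappa>_def set_lebesgue_integral_def
      by (rule integral_Re) (use int in \<open>simp add: set_integrable_def\<close>)
    then have "integral\<^sup>L lborel ?r = 0" by (simp add: \<open>\<kappa> = 0\<close>)
    then have "AE u in lborel. ?r u = 0"
      by (subst (asm) integral_nonneg_eq_0_iff_AE[OF r]) (auto simp: indicator_def intro!: AE_I2 less_imp_le[OF pos])
    then have "AE u in lborel. u \<notin> {0<..<1::real}"
      by eventually_elim (use pos in \<open>force simp: indicator_def\<close>)
    then have "{0<..<1::real} \<in> null_sets lborel"
      by (subst (asm) AE_iff_null_sets[symmetric]) auto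
    then show False by (simp add: null_sets_def)
  qed
  fix \<omega> :: real assume \<omega>: "\<omega> > 0"
  let ?g = "\<lambda>\<tau>. \<i> * of_real (\<omega> * \<tau>) / (1 + \<i> * of_real (\<omega> * \<tau>)) * of_real \<tau> powr of_real (- \<beta>) / complex_of_real \<tau>"
  \<comment> \<open>The single factor \<open>\<omega>\<close> is the Jacobian of the substitution
    and cancels in the integral.\<close>
  have g: "?g \<tau> = of_real (\<omega> * \<omega> powr \<beta>) * \<phi> (\<omega> * \<tau>)" if "\<tau> > 0" for \<tau>
  proof -
    have "\<phi> (\<omega> * \<tau>) = \<i> / (1 + \<i> * of_real (\<omega> * \<tau>)) * of_real ((\<omega> * \<tau>) powr (- \<beta>))"
      by (rule \<phi>) (use that \<omega> in simp)
    moreover have "(\<omega> * \<tau>) powr (- \<beta>) = \<tau> powr (- \<beta>) / \<omega> powr \<beta>"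
      using that \<omega> by (simp add: powr_mult powr_minus field_simps)
    moreover have "?g \<tau> = of_real \<omega> * (\<i> / (1 + \<i> * of_real (\<omega> * \<tau>)) * of_real (\<tau> powr (- \<beta>)))"
      unfolding powr[OF that] using that by simp
    ultimately show ?thesis using \<omega> by simp
  qed
  show "set_integrable lborel {0<..} ?g"
  proof (subst set_integrable_cong[OF refl refl g])
    show "set_integrable lborel {0<..} (\<lambda>\<tau>. of_real (\<omega> * \<omega> powr \<beta>) * \<phi> (\<omega> * \<tau>))"
      using int set_integrable_dilate_iff[OF \<omega>, of \<phi>] by (intro set_integrable_mult_right) simp
  qed simp
  have "(LINT \<tau>:{0<..}|lborel. ?g \<tau>) = (LINT \<tau>:{0<..}|lborel. of_real (\<omega> * \<omega> powr \<beta>) * \<phi> (\<omega> * \<tau>))"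
    by (rule set_lebesgue_integral_cong) (use g in auto)
  also have "\<dots> = of_real (\<omega> powr \<beta>) * \<kappa>"
    unfolding \<kappa>_def set_integral_dilate[OF \<omega>, of \<phi>] by (simp add: scaleR_conv_of_real)
  also have "of_real (\<omega> powr \<beta>) = complex_of_real \<omega> powr of_real \<beta>"
    using powr_of_real[of \<omega> \<beta>] \<omega> by simp
  finally show "(LINT \<tau>:{0<..}|lborel. ?g \<tau>) = \<kappa> * of_real \<omega> powr of_real \<beta>"
    by (simp add: mult.commute)
qed

text \<open>The integrand at \<open>\<omega> = 1\<close> is measurable, and multiplying by the
  continuous function \<open>(1 + \<i> * \<tau>) / \<i>\<close> recovers \<open>H\<close> on
  positive arguments.\<close>

lemma represents_imp_set_borel_measurable:
  assumes "represents H Ginf G"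
  shows "set_borel_measurable lborel {0<..} H"
proof -
  let ?k = "\<lambda>\<tau>. \<i> * of_real (1 * \<tau>) / (1 + \<i> * complex_of_real (1 * \<tau>)) * H \<tau> / of_real \<tau>"
  have nz: "1 + \<i> * complex_of_real u \<noteq> 0" for u by (simp add: complex_eq_iff)
  have "set_integrable lborel {0<..} ?k"
    using assms unfolding represents_def by (metis zero_less_one)
  then have "set_borel_measurable lborel {0<..} ?k"
    unfolding set_integrable_def set_borel_measurable_def by simp
  moreover have "set_borel_measurable lborel {0<..} (\<lambda>\<tau>. (1 + \<i> * complex_of_real \<tau>) / \<i>)"
    by (intro set_borel_measurable_lborel_continuous continuous_intros) auto
  ultimately have "set_borel_measurable lborel {0<..} (\<lambda>\<tau>. ?k \<tau> * ((1 + \<i> * complex_of_real \<tau>) / \<i>))"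
    by (rule set_borel_measurable_mult)
  also have "(\<lambda>\<tau>. indicator {0<..} \<tau> *\<^sub>R (?k \<tau> * ((1 + \<i> * complex_of_real \<tau>) / \<i>))) = (\<lambda>\<tau>. indicator {0<..} \<tau> *\<^sub>R H \<tau>)"
    using nz by (auto simp: indicator_def fun_eq_iff mult_ac)
  then have "set_borel_measurable lborel {0<..} (\<lambda>\<tau>. ?k \<tau> * ((1 + \<i> * complex_of_real \<tau>) / \<i>)) = set_borel_measurable lborel {0<..} H"
    unfolding set_borel_measurable_def by (rule arg_cong)
  finally show ?thesis .
qed

text \<open>Subtracting from \<open>H\<close> the power spectrum that produces \<open>G\<close>
  leaves \<open>E\<close>, whose Stieltjes transform is the constant \<open>\<i> * Ginf\<close>. By
  dominated convergence the transform tends to 0 along the integers, so \<open>Ginf = 0\<close>, and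
  injectivity gives \<open>E = 0\<close> almost everywhere.\<close>

lemma represents_power_imp_power_spectrum:
  fixes C :: complex and \<beta> :: real
  assumes \<beta>: "0 < \<beta>" "\<beta> < 1" and C: "C \<noteq> 0"
    and G: "\<And>\<omega>. \<omega> > 0 \<Longrightarrow> G \<omega> = C * of_real \<omega> powr of_real \<beta>"
    and H: "represents H Ginf G"
  obtains h where "h \<noteq> 0" "AE \<tau> in lborel. \<tau> > 0 \<longrightarrow> H \<tau> = h * of_real \<tau> powr of_real (- \<beta>)"
proof -
  obtain \<kappa> :: complex where \<kappa>: "\<kappa> \<noteq> 0"
    and p_int: "\<And>\<omega>. \<omega> > 0 \<Longrightarrow> set_integrable lborel {0<..}
       (\<lambda>\<tau>. \<i> * of_real (\<omega> * \<tau>) / (1 + \<i> * of_real (\<omega> * \<tau>)) * of_real \<tau> powr of_real (- \<beta>) / of_real \<tau>)"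
    and p_eq: "\<And>\<omega>. \<omega> > 0 \<Longrightarrow> (LINT \<tau>:{0<..}|lborel.
       \<i> * of_real (\<omega> * \<tau>) / (1 + \<i> * of_real (\<omega> * \<tau>)) * of_real \<tau> powr of_real (- \<beta>) / of_real \<tau>) =
       \<kappa> * of_real \<omega> powr of_real \<beta>"
    by (rule power_spectrum_integral[OF \<beta>]) blast
  define h where "h = C / \<kappa>"
  define E where "E \<tau> = H \<tau> - h * of_real \<tau> powr of_real (- \<beta>)" for \<tau>
  have E: "set_integrable lborel {0<..} (\<lambda>\<tau>. E \<tau> / (of_real x + \<i> * of_real \<tau>)) \<and>
      (LINT \<tau>:{0<..}|lborel. E \<tau> / (of_real x + \<i> * of_real \<tau>)) = \<i> * Ginf" if "x > 0" for x
  proof -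
    \<comment> \<open>With this frequency the kernel divided by \<open>\<tau>\<close> is
      \<open>\<i> / (x + \<i> * \<tau>)\<close>, so the representation reads as a Stieltjes
      transform at \<open>x\<close>.\<close>
    define \<omega> where "\<omega> = 1 / x"
    have \<omega>: "\<omega> > 0" using that by (simp add: \<omega>_def)
    let ?k = "\<lambda>\<tau>. \<i> * of_real (\<omega> * \<tau>) / (1 + \<i> * complex_of_real (\<omega> * \<tau>))"
    have H1: "set_integrable lborel {0<..} (\<lambda>\<tau>. ?k \<tau> * H \<tau> / of_real \<tau>)"
      and H2: "C * of_real \<omega> powr of_real \<beta> = Ginf + (LINT \<tau>:{0<..}|lborel. ?k \<tau> * H \<tau> / of_real \<tau>)"
      using H G[OF \<omega>] \<omega> unfolding represents_def by auto
    have P1: "set_integrable lborel {0<..} (\<lambda>\<tau>. h * (?k \<tau> * of_real \<tau> powr of_real (- \<beta>) / of_real \<tau>))"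
      using p_int[OF \<omega>] by (rule set_integrable_mult_right)
    have eq: "E \<tau> / (of_real x + \<i> * of_real \<tau>) =
        - \<i> * (?k \<tau> * H \<tau> / of_real \<tau> - h * (?k \<tau> * of_real \<tau> powr of_real (- \<beta>) / of_real \<tau>))" if "\<tau> > 0" for \<tau>
    proof -
      have nz: "complex_of_real x + \<i> * of_real \<tau> \<noteq> 0" "1 + \<i> * complex_of_real (\<omega> * \<tau>) \<noteq> 0"
        using that by (auto simp: complex_eq_iff)
      have "?k \<tau> / of_real \<tau> = \<i> / (of_real x + \<i> * of_real \<tau>)"
      proof -
        have "1 + \<i> * complex_of_real (\<omega> * \<tau>) = (of_real x + \<i> * of_real \<tau>) / of_real x"
          using \<open>x > 0\<close> by (simp add: \<omega>_def field_simps)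
        then show ?thesis
          using that \<open>x > 0\<close> nz(1) by (simp add: \<omega>_def)
      qed
      then have "- \<i> * (?k \<tau> / of_real \<tau> * E \<tau>) = E \<tau> / (of_real x + \<i> * of_real \<tau>)"
        by simp
      then show ?thesis
        by (simp add: E_def algebra_simps diff_divide_distrib)
    qed
    have 1: "set_integrable lborel {0<..} (\<lambda>\<tau>. - \<i> * (?k \<tau> * H \<tau> / of_real \<tau> - h * (?k \<tau> * of_real \<tau> powr of_real (- \<beta>) / of_real \<tau>)))"
      by (intro set_integrable_mult_right set_integral_diff(1) H1 P1)
    have "(LINT \<tau>:{0<..}|lborel. E \<tau> / (of_real x + \<i> * of_real \<tau>)) =
      (LINT \<tau>:{0<..}|lborel. - \<i> * (?k \<tau> * H \<tau> / of_real \<tau> - h * (?k \<tau> * of_real \<tau> powr of_real (- \<beta>) / of_real \<tau>)))"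
      by (rule set_lebesgue_integral_cong) (use eq in auto)
    also have "\<dots> = - \<i> * ((LINT \<tau>:{0<..}|lborel. ?k \<tau> * H \<tau> / of_real \<tau>) - h * (\<kappa> * of_real \<omega> powr of_real \<beta>))"
      unfolding set_integral_mult_right set_integral_diff(2)[OF H1 P1] p_eq[OF \<omega>] ..
    also have "\<dots> = \<i> * Ginf"
    proof -
      have "h * (\<kappa> * of_real \<omega> powr of_real \<beta>) = C * of_real \<omega> powr of_real \<beta>"
        using \<kappa> by (simp add: h_def)
      then show ?thesis unfolding H2 by (simp add: algebra_simps)
    qed
    finally have 2: "(LINT \<tau>:{0<..}|lborel. E \<tau> / (of_real x + \<i> * of_real \<tau>)) = \<i> * Ginf" .
    have "set_integrable lborel {0<..} (\<lambda>\<tau>. E \<tau> / (of_real x + \<i> * of_real \<tau>))"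
      by (subst set_integrable_cong[OF refl refl eq]) (use 1 in auto)
    with 2 show ?thesis by blast
  qed
  let ?f = "\<lambda>x \<tau>. indicator {0<..} \<tau> *\<^sub>R (E \<tau> / (complex_of_real x + \<i> * of_real \<tau>))"
  have int: "integrable lborel (?f x)" if "x > 0" for x
    using E[OF that] by (simp add: set_integrable_def)
  have "(\<lambda>n. LINT \<tau>|lborel. ?f (real (Suc n)) \<tau>) \<longlonglongrightarrow> integral\<^sup>L (lborel :: real measure) (\<lambda>_. 0 :: complex)"
  proof (rule integral_dominated_convergence[where w = "\<lambda>\<tau>. norm (?f 1 \<tau>)"])
    show "AE \<tau> in lborel. norm (?f (real (Suc n)) \<tau>) \<le> norm (?f 1 \<tau>)" for n
    proof (rule AE_I2)
      fix \<tau> :: real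
      have "norm (complex_of_real 1 + \<i> * of_real \<tau>) \<le> norm (complex_of_real (real (Suc n)) + \<i> * of_real \<tau>)"
        by (simp add: cmod_def power2_eq_square algebra_simps)
      then show "norm (?f (real (Suc n)) \<tau>) \<le> norm (?f 1 \<tau>)"
        by (auto simp: indicator_def norm_divide complex_eq_iff simp del: of_nat_Suc intro!: divide_left_mono mult_pos_pos)
    qed
    show "AE \<tau> in lborel. (\<lambda>n. ?f (real (Suc n)) \<tau>) \<longlonglongrightarrow> 0"
    proof (rule AE_I2)
      fix \<tau> :: real
      show "(\<lambda>n. ?f (real (Suc n)) \<tau>) \<longlonglongrightarrow> 0"
      proof (rule Lim_null_comparison)
        show "\<forall>\<^sub>F n in sequentially. norm (?f (real (Suc n)) \<tau>) \<le> norm (E \<tau>) / real (Suc n)"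
        proof (intro always_eventually allI)
          fix n
          have "real (Suc n) \<le> norm (complex_of_real (real (Suc n)) + \<i> * of_real \<tau>)"
            using complex_Re_le_cmod[of "complex_of_real (real (Suc n)) + \<i> * of_real \<tau>"] by simp
          then have "norm (E \<tau>) / norm (complex_of_real (real (Suc n)) + \<i> * of_real \<tau>) \<le> norm (E \<tau>) / real (Suc n)"
            by (intro divide_left_mono mult_pos_pos) auto
          then show "norm (?f (real (Suc n)) \<tau>) \<le> norm (E \<tau>) / real (Suc n)"
            by (auto simp: indicator_def norm_divide simp del: of_nat_Suc)
        qed
        show "(\<lambda>n. norm (E \<tau>) / real (Suc n)) \<longlonglongrightarrow> 0"
          by (rule LIMSEQ_Suc[OF lim_const_over_n])
      qed
    qed
    show "integrable lborel (\<lambda>\<tau>. norm (?f 1 \<tau>))"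
      by (rule integrable_norm[OF int]) simp
    show "?f (real (Suc n)) \<in> borel_measurable lborel" for n
      by (rule borel_measurable_integrable[OF int]) simp
  qed simp
  moreover have "(LINT \<tau>|lborel. ?f (real (Suc n)) \<tau>) = \<i> * Ginf" for n
    using E[of "real (Suc n)"] by (simp add: set_lebesgue_integral_def del: of_nat_Suc)
  ultimately have "Ginf = 0"
    by (simp add: LIMSEQ_const_iff)
  have "AE \<tau> in lborel. \<tau> > 0 \<longrightarrow> E \<tau> = 0"
    by (rule stieltjes_transform_zero_imp_AE_zero) (use E[of 1] E \<open>Ginf = 0\<close> in auto)
  then have "AE \<tau> in lborel. \<tau> > 0 \<longrightarrow> H \<tau> = h * of_real \<tau> powr of_real (- \<beta>)"
    by (simp add: E_def)
  moreover have "h \<noteq> 0" using C \<kappa> by (simp add: h_def)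
  ultimately show ?thesis by (rule that[rotated])
qed

lemma power_law_eq_powr:
  assumes "\<tau>\<^sub>0 > 0" "t > 0"
  shows "power_law G\<^sub>0 \<tau>\<^sub>0 \<beta> t =
      (of_real G\<^sub>0 * of_real \<tau>\<^sub>0 powr of_real \<beta> * \<i> powr of_real \<beta>) * of_real t powr of_real \<beta>"
proof -
  have "(\<i> * of_real (t * \<tau>\<^sub>0)) powr of_real \<beta> = (of_real t * (of_real \<tau>\<^sub>0 * \<i>)) powr of_real \<beta>"
    by (simp add: mult_ac)
  also have "\<dots> = of_real t powr of_real \<beta> * (of_real \<tau>\<^sub>0 * \<i>) powr of_real \<beta>"
    using assms by (intro powr_times_real_left) auto
  also have "(of_real \<tau>\<^sub>0 * \<i>) powr of_real \<beta> = of_real \<tau>\<^sub>0 powr of_real \<beta> * \<i> powr of_real \<beta>"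
    using assms by (intro powr_times_real_left) auto
  finally show ?thesis
    by (simp add: power_law_def mult_ac)
qed

theorem proposition5:
  fixes G\<^sub>0 \<tau>\<^sub>0 \<beta> :: real
  assumes "G\<^sub>0 > 0" and "\<tau>\<^sub>0 > 0" and "0 < \<beta>" and "\<beta> < 1"
  shows "\<not> (\<exists>H Ginf. represents H Ginf (power_law G\<^sub>0 \<tau>\<^sub>0 \<beta>) \<and> spectrum_in H extended_fox_class) \<and>
         \<not> (\<exists>F\<in>extended_fox_class. \<exists>Ginf. mellin_represents F Ginf (power_law G\<^sub>0 \<tau>\<^sub>0 \<beta>))"
proof -
  define C where "C = of_real G\<^sub>0 * of_real \<tau>\<^sub>0 powr of_real \<beta> * \<i> powr complex_of_real \<beta>"
  have C: "C \<noteq> 0" using assms by (simp add: C_def)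
  have G: "power_law G\<^sub>0 \<tau>\<^sub>0 \<beta> t = C * of_real t powr of_real \<beta>" if "t > 0" for t
    unfolding C_def by (rule power_law_eq_powr) (use assms that in auto)
  have False if H: "represents H Ginf (power_law G\<^sub>0 \<tau>\<^sub>0 \<beta>)" and F: "F \<in> extended_fox_class" "has_mellin H F"
    for H Ginf F
  proof -
    obtain h where h: "h \<noteq> 0" "AE \<tau> in lborel. \<tau> > 0 \<longrightarrow> H \<tau> = h * of_real \<tau> powr of_real (- \<beta>)"
      using represents_power_imp_power_spectrum[OF assms(3,4) C G H] by blast
    have "set_borel_measurable lborel {0<..} (\<lambda>\<tau>. h * of_real \<tau> powr of_real (- \<beta>))"
      by (intro set_borel_measurable_lborel_continuous continuous_intros) auto
    then have "has_mellin (\<lambda>\<tau>. h * of_real \<tau> powr of_real (- \<beta>)) F"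
      by (rule has_mellin_AE_transfer[OF h(2) represents_imp_set_borel_measurable[OF H] _ F(2)])
    moreover have "\<not> has_mellin (\<lambda>\<tau>. h * of_real \<tau> powr of_real (- \<beta>)) F"
      by (rule power_minus_const_not_has_mellin[where C = h and D = 0 and p = "- \<beta>"])
        (use h(1) assms extended_fox_class_countable_zeros[OF F(1)] in auto)
    ultimately show False by blast
  qed
  moreover have False if F: "F \<in> extended_fox_class" and "mellin_represents F Ginf (power_law G\<^sub>0 \<tau>\<^sub>0 \<beta>)" for F Ginf
  proof -
    \<comment> \<open>The product can vanish only at zeros of the kernel and at reflections of zeros
      of \<open>F\<close>.\<close>
    have "countable (uminus ` {s. F s = 0} \<union> {s. mellin_kernel s = 0})"
      using extended_fox_class_countable_zeros[OF F] mellin_kernel_countable_zeros by simp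
    then have "countable {s. mellin_kernel s * F (- s) = 0}"
      by (rule countable_subset[rotated]) (force simp: image_iff)
    then have "\<not> has_mellin (\<lambda>\<omega>. power_law G\<^sub>0 \<tau>\<^sub>0 \<beta> \<omega> - Ginf) (\<lambda>s. mellin_kernel s * F (- s))"
      by (intro power_minus_const_not_has_mellin[where C = C and D = Ginf and p = \<beta>]) (use C assms G in auto)
    with that show False by (simp add: mellin_represents_def)
  qed
  ultimately show ?thesis
    unfolding spectrum_in_def by blast
qed

end
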